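(* Let $N$ be a positive integer with $\gcd(N,6)=1$, and let $f(\tau)=\prod_{\delta\mid N}\eta^{r_\delta}(\delta\tau)$ with integers $r_\delta$. Put $k=\frac12\sum_{\delta\mid N}r_\delta$ and suppose $f\in M_k^!(\Gamma(N))$. Then $f\in M_k^!(\Gamma_0(N),\chi)$, where $\chi(d)=\left(\frac{(-1)^k s}{d}\right)$ with $s=\prod_{\delta\mid N}\delta^{r_\delta}$; that is, $f(M\tau)=\chi(d)(c\tau+d)^k f(\tau)$ for all $M=\begin{psmallmatrix}a&b\\c&d\end{psmallmatrix}\in\Gamma_0(N)$.
   Context: Dedekind's eta function is $\eta(\tau)=q^{1/24}\prod_{n\ge1}(1-q^n)$, $q=e^{2\pi i\tau}$, $\tau$ in the upper half-plane $\mathbb H$. An eta-quotient of level $N$ is a function $\prod_{\delta\mid N}\eta^{r_\delta}(\delta\tau)$ with $r_\delta\in\mathbb Z$. For a congruence subgroup $\Gamma$, $M_k^!(\Gamma)$ denotes the space of weakly holomorphic modular forms of weight $k$ on $\Gamma$: functions holomorphic on $\mathbb H$, meromorphic at the cusps, satisfying $f(A\tau)=(c\tau+d)^k f(\tau)$ for all $A=\begin{psmallmatrix}a&b\\c&d\end{psmallmatrix}\in\Gamma$; $M_k^!(\Gamma_0(N),\chi)$ is the analogous space with Nebentypus $\chi$, i.e. $f(A\tau)=\chi(d)(c\tau+d)^kf(\tau)$ for $A\in\Gamma_0(N)$. The symbol $\left(\frac{\cdot}{d}\right)$ is the (Kronecker) Legendre symbol. *)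

theory Defs
  imports "HOL-Complex_Analysis.Complex_Analysis" "HOL-Number_Theory.Number_Theory"
begin

no_notation fps_nth (infixl \<open>$\<close> 75)

definition upper_half_plane :: "complex set" where
  "upper_half_plane = {\<tau>. Im \<tau> > 0}"

definition dedekind_eta :: "complex \<Rightarrow> complex" where
  "dedekind_eta \<tau> =
     exp (2 * pi * \<i> * \<tau> / 24) * (\<Prod>n. 1 - exp (2 * pi * \<i> * \<tau>) ^ Suc n)"

definition eta_quotient :: "nat \<Rightarrow> (nat \<Rightarrow> int) \<Rightarrow> complex \<Rightarrow> complex" where
  "eta_quotient N r \<tau> = (\<Prod>\<delta> | \<delta> dvd N. dedekind_eta (of_nat \<delta> * \<tau>) powi r \<delta>)"

definition SL2Z :: "(int ^ 2 ^ 2) set" where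
  "SL2Z = {A. det A = 1}"

definition Gamma_principal :: "nat \<Rightarrow> (int ^ 2 ^ 2) set" where
  "Gamma_principal N = {A \<in> SL2Z.
     [A $ 1 $ 1 = 1] (mod int N) \<and> [A $ 1 $ 2 = 0] (mod int N) \<and>
     [A $ 2 $ 1 = 0] (mod int N) \<and> [A $ 2 $ 2 = 1] (mod int N)}"

definition Gamma_0 :: "nat \<Rightarrow> (int ^ 2 ^ 2) set" where
  "Gamma_0 N = {A \<in> SL2Z. [A $ 2 $ 1 = 0] (mod int N)}"

definition act :: "int ^ 2 ^ 2 \<Rightarrow> complex \<Rightarrow> complex" where
  "act A = moebius (of_int (A $ 1 $ 1)) (of_int (A $ 1 $ 2))
                   (of_int (A $ 2 $ 1)) (of_int (A $ 2 $ 2))"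

definition aut_factor :: "int ^ 2 ^ 2 \<Rightarrow> complex \<Rightarrow> complex" where
  "aut_factor A \<tau> = of_int (A $ 2 $ 1) * \<tau> + of_int (A $ 2 $ 2)"

definition slash :: "int \<Rightarrow> (complex \<Rightarrow> complex) \<Rightarrow> int ^ 2 ^ 2 \<Rightarrow> complex \<Rightarrow> complex" where
  "slash k f A \<tau> = aut_factor A \<tau> powi (-k) * f (act A \<tau>)"

text \<open>Every cusp is the image of \<open>\<infinity>\<close> under some element of \<open>SL2Z\<close>. Meromorphy there means that
  the translate by that element is a function of \<open>exp (2 \<pi> \<i> \<tau> / h)\<close>, for some period \<open>h\<close>, which is
  meromorphic at \<open>0\<close>. The value of \<open>g\<close> at \<open>0\<close> itself is irrelevant.\<close>

definition meromorphic_at_cusps :: "int \<Rightarrow> (complex \<Rightarrow> complex) \<Rightarrow> bool" where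
  "meromorphic_at_cusps k f \<longleftrightarrow>
     (\<forall>A\<in>SL2Z. \<exists>h::nat. h > 0 \<and> (\<exists>g. g meromorphic_on {0} \<and>
        (\<forall>\<tau>\<in>upper_half_plane. slash k f A \<tau> = g (exp (2 * pi * \<i> * \<tau> / of_nat h)))))"

definition weakly_holomorphic_forms :: "int \<Rightarrow> (int ^ 2 ^ 2) set \<Rightarrow> (complex \<Rightarrow> complex) set" where
  "weakly_holomorphic_forms k \<Gamma> = {f.
     f holomorphic_on upper_half_plane \<and> meromorphic_at_cusps k f \<and>
     (\<forall>A\<in>\<Gamma>. \<forall>\<tau>\<in>upper_half_plane. f (act A \<tau>) = aut_factor A \<tau> powi k * f \<tau>)}"

definition weakly_holomorphic_forms_char ::
    "int \<Rightarrow> nat \<Rightarrow> (int \<Rightarrow> complex) \<Rightarrow> (complex \<Rightarrow> complex) set" where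
  "weakly_holomorphic_forms_char k N chi = {f.
     f holomorphic_on upper_half_plane \<and> meromorphic_at_cusps k f \<and>
     (\<forall>A\<in>Gamma_0 N. \<forall>\<tau>\<in>upper_half_plane.
        f (act A \<tau>) = chi (A $ 2 $ 2) * aut_factor A \<tau> powi k * f \<tau>)}"

definition kronecker_prime :: "int \<Rightarrow> int \<Rightarrow> int" where
  "kronecker_prime a p =
     (if p = 2 then (if even a then 0 else if a mod 8 \<in> {1, 7} then 1 else -1)
      else Legendre a p)"

definition kronecker :: "int \<Rightarrow> int \<Rightarrow> int" where
  "kronecker a n =
     (if n = 0 then (if \<bar>a\<bar> = 1 then 1 else 0)
      else (if n < 0 \<and> a < 0 then -1 else 1) *
           (\<Prod>p\<in>prime_factors n. kronecker_prime a p ^ multiplicity p n))"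

text \<open>The extension to rational upper arguments that is multiplicative in \<open>x\<close>: since the symbol takes
  the values \<open>1\<close> and \<open>-1\<close> on integers coprime to \<open>n\<close>, a denominator contributes the same factor as
  a numerator would. It is needed because \<open>\<Prod>\<delta>. \<delta> powi r \<delta>\<close> need not be an integer.\<close>

definition kronecker_rat :: "rat \<Rightarrow> int \<Rightarrow> int" where
  "kronecker_rat x n = kronecker (fst (quotient_of x)) n * kronecker (snd (quotient_of x)) n"

end

theory Submission
  imports Defs "HOL-Computational_Algebra.Fundamental_Theorem_Algebra"
begin

text \<open>
  The multiplier of the eta-quotient is computed without Dedekind sums. By Liouville's theorem the
  function \<open>\<theta>\<^sub>1(z|\<tau>) / \<eta>(\<tau>)\<^sup>3\<close> obeys a transformation law under the full modular group that contains
  no root of unity. For an odd prime \<open>p\<close> its values at a half-system of \<open>p\<close>-torsion points multiply to a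
  constant times \<open>\<eta>(p \<tau>) / \<eta>(\<tau>)\<^sup>p\<close>, and a matrix with \<open>p\<^sup>2 | c\<close> permutes these values up to signs whose
  product is \<open>(d/p)\<close> by Gauss's lemma. Induction over the prime factors of \<open>\<delta>\<close> gives
  \<open>\<eta>(\<delta> M\<tau>) / \<eta>(\<delta> \<tau>) = (d/\<delta>) (c \<tau> + d)\<close> to the power \<open>(1 - \<delta>)/2\<close> times \<open>(\<eta>(M\<tau>) / \<eta>(\<tau>))\<^sup>\<delta>\<close>; in the same
  way the \<open>2\<close>-torsion points give the weight \<open>12\<close> law of \<open>\<eta>\<close> to the power \<open>24\<close>. Invariance under
  \<open>\<tau> \<mapsto> \<tau> + N\<close> forces \<open>24\<close> to divide \<open>\<Sum>\<delta>. \<delta> r\<^sub>\<delta>\<close>, so the powers of \<open>\<eta>(M\<tau>) / \<eta>(\<tau>)\<close> combine, and the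
  multiplier is \<open>\<Prod>\<delta>. (d/\<delta>)\<close> with exponents \<open>r\<^sub>\<delta>\<close> for \<open>N\<^sup>2 | c\<close>; the group \<open>\<Gamma>(N)\<close> reduces \<open>\<Gamma>\<^sub>0(N)\<close> to this
  case. Finally the congruence \<open>\<Sum>\<delta>. r\<^sub>\<delta> (\<delta> - 1)/2 \<equiv> k\<close> modulo \<open>2\<close> turns the product into \<open>\<chi>(d)\<close> by
  quadratic reciprocity.
\<close>

section \<open>The infinite q-Pochhammer symbol\<close>

definition qpoch :: "complex \<Rightarrow> complex \<Rightarrow> complex" where
  "qpoch w q = (\<Prod>n. 1 - w * q ^ n)"

lemma convergent_prod_qpoch:
  fixes w q :: complex
  assumes "norm q < 1"
  shows "convergent_prod (\<lambda>n. 1 - w * q ^ n)"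
proof (rule abs_convergent_prod_imp_convergent_prod, rule summable_imp_abs_convergent_prod)
  have "summable (\<lambda>n. norm w * norm q ^ n)"
    using assms by (intro summable_mult summable_geometric) auto
  then show "summable (\<lambda>n. norm (1 - w * q ^ n - 1))"
    by (simp add: norm_mult norm_power)
qed

lemma qpoch_LIMSEQ:
  assumes "norm q < 1"
  shows "(\<lambda>n. \<Prod>i\<le>n. 1 - w * q ^ i) \<longlonglongrightarrow> qpoch w q"
  unfolding qpoch_def by (intro convergent_prod_LIMSEQ convergent_prod_qpoch assms)

lemma qpoch_rec:
  assumes "norm q < 1"
  shows "qpoch w q = (1 - w) * qpoch (w * q) q"
proof (rule LIMSEQ_unique)
  show "(\<lambda>n. \<Prod>i\<le>Suc n. 1 - w * q ^ i) \<longlonglongrightarrow> qpoch w q"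
    using qpoch_LIMSEQ[OF assms] by (rule LIMSEQ_Suc)
  have "(\<lambda>n. (1 - w) * (\<Prod>i\<le>n. 1 - (w * q) * q ^ i)) \<longlonglongrightarrow> (1 - w) * qpoch (w * q) q"
    by (intro tendsto_mult tendsto_const qpoch_LIMSEQ assms)
  also have "(\<lambda>n. (1 - w) * (\<Prod>i\<le>n. 1 - (w * q) * q ^ i)) = (\<lambda>n. \<Prod>i\<le>Suc n. 1 - w * q ^ i)"
    by (subst prod.atMost_Suc_shift) (simp add: mult_ac)
  finally show "(\<lambda>n. \<Prod>i\<le>Suc n. 1 - w * q ^ i) \<longlonglongrightarrow> (1 - w) * qpoch (w * q) q" .
qed

text \<open>A convergent infinite product vanishes only if one of its factors does.\<close>

lemma qpoch_eq_0_iff: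
  assumes "norm q < 1"
  shows "qpoch w q = 0 \<longleftrightarrow> (\<exists>n. w * q ^ n = 1)"
proof -
  have "(\<lambda>n. 1 - w * q ^ n) has_prod qpoch w q"
    unfolding qpoch_def using convergent_prod_qpoch[OF assms] by (rule convergent_prod_has_prod)
  from has_prod_eq_0_iff[OF this] show ?thesis
    by (auto simp: eq_commute[of 1])
qed

lemma qpoch_q_nonzero:
  assumes "norm q < 1"
  shows "qpoch q q \<noteq> 0"
proof
  assume "qpoch q q = 0"
  then obtain n where "q ^ Suc n = 1"
    using assms by (auto simp: qpoch_eq_0_iff)
  then have "norm q ^ Suc n = 1"
    by (metis norm_one norm_power)
  then show False
    using assms power_Suc_less_one[of "norm q" n] by (cases "norm q = 0") auto
qed

text \<open>The partial products converge uniformly on closed discs of radius 1, by the M-test with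
  a geometric majorant, so the limit is entire in \<open>w\<close>.\<close>

lemma holomorphic_qpoch:
  assumes "norm q < 1"
  shows "(\<lambda>w. qpoch w q) holomorphic_on UNIV"
proof (rule holomorphic_uniform_sequence)
  fix x :: complex
  have "uniformly_convergent_on (cball x 1) (\<lambda>N w. \<Prod>n<N. 1 + (- w * q ^ n))"
  proof (rule uniformly_convergent_on_prod)
    show "uniformly_convergent_on (cball x 1) (\<lambda>N w. \<Sum>n<N. norm (- w * q ^ n))"
    proof (rule Weierstrass_m_test'_ev)
      have "norm w \<le> norm x + 1" if "w \<in> cball x 1" for w
        using that norm_triangle_ineq2[of w x] by (auto simp: dist_norm norm_minus_commute)
      then show "\<forall>\<^sub>F n in sequentially. \<forall>w\<in>cball x 1.
          norm (norm (- w * q ^ n)) \<le> (norm x + 1) * norm q ^ n"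
        by (intro always_eventually) (auto simp: norm_mult norm_power intro!: mult_right_mono)
      show "summable (\<lambda>n. (norm x + 1) * norm q ^ n)"
        using assms by (intro summable_mult summable_geometric) auto
    qed
  qed (auto intro!: continuous_intros)
  then have "uniform_limit (cball x 1) (\<lambda>N w. \<Prod>n<N. 1 + (- w * q ^ n))
      (\<lambda>w. lim (\<lambda>N. \<Prod>n<N. 1 + (- w * q ^ n))) sequentially"
    by (simp add: uniformly_convergent_uniform_limit_iff)
  moreover have "lim (\<lambda>N. \<Prod>n<N. 1 + (- w * q ^ n)) = qpoch w q" for w
  proof (rule limI)
    show "(\<lambda>N. \<Prod>n<N. 1 + (- w * q ^ n)) \<longlonglongrightarrow> qpoch w q"
      using qpoch_LIMSEQ[OF assms, of w]
      by (subst filterlim_sequentially_Suc [symmetric]) (simp add: lessThan_Suc_atMost)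
  qed
  ultimately show "\<exists>d>0. cball x d \<subseteq> UNIV \<and>
      uniform_limit (cball x d) (\<lambda>N w. \<Prod>n<N. 1 + (- w * q ^ n)) (\<lambda>w. qpoch w q) sequentially"
    by (intro exI[of _ 1]) auto
qed (auto intro!: holomorphic_intros)

lemma qpoch_prod:
  assumes "norm q < 1" "finite A"
  shows "(\<lambda>n. \<Prod>i\<le>n. \<Prod>a\<in>A. 1 - w a * q ^ i) \<longlonglongrightarrow> (\<Prod>a\<in>A. qpoch (w a) q)"
  by (subst prod.swap) (intro tendsto_prod qpoch_LIMSEQ assms)

lemma qpoch_even_odd:
  assumes "norm q < 1"
  shows "qpoch w q = qpoch w (q\<^sup>2) * qpoch (w * q) (q\<^sup>2)"
proof (rule LIMSEQ_unique)
  have q2: "norm (q\<^sup>2) < 1"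
    using assms by (simp add: norm_power power_less_one_iff)
  \<comment> \<open>Stopping at the odd index \<open>2 * n + 1\<close> leaves \<open>n + 1\<close>
    even and \<open>n + 1\<close> odd exponents, so the finite products already split.\<close>
  have "strict_mono (\<lambda>n::nat. 2 * n + 1)"
    by (auto simp: strict_mono_def)
  from LIMSEQ_subseq_LIMSEQ[OF qpoch_LIMSEQ[OF assms] this]
  show "(\<lambda>n. \<Prod>i\<le>2 * n + 1. 1 - w * q ^ i) \<longlonglongrightarrow> qpoch w q"
    by (simp add: o_def)
  have "(\<Prod>i\<le>2 * n + 1. 1 - w * q ^ i) =
      (\<Prod>i\<le>n. 1 - w * (q\<^sup>2) ^ i) * (\<Prod>i\<le>n. 1 - (w * q) * (q\<^sup>2) ^ i)" for n
    by (induction n) (simp_all add: power_mult [symmetric] mult_ac)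
  moreover have "(\<lambda>n. (\<Prod>i\<le>n. 1 - w * (q\<^sup>2) ^ i) * (\<Prod>i\<le>n. 1 - (w * q) * (q\<^sup>2) ^ i))
      \<longlonglongrightarrow> qpoch w (q\<^sup>2) * qpoch (w * q) (q\<^sup>2)"
    by (intro tendsto_mult qpoch_LIMSEQ q2)
  ultimately show "(\<lambda>n. \<Prod>i\<le>2 * n + 1. 1 - w * q ^ i)
      \<longlonglongrightarrow> qpoch w (q\<^sup>2) * qpoch (w * q) (q\<^sup>2)"
    by simp
qed

lemma qpoch_square:
  assumes "norm q < 1"
  shows "qpoch (w\<^sup>2) (q\<^sup>2) = qpoch w q * qpoch (- w) q"
proof (rule LIMSEQ_unique)
  have q2: "norm (q\<^sup>2) < 1"
    using assms by (simp add: norm_power power_less_one_iff)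
  show "(\<lambda>n. \<Prod>i\<le>n. 1 - w\<^sup>2 * (q\<^sup>2) ^ i) \<longlonglongrightarrow> qpoch (w\<^sup>2) (q\<^sup>2)"
    by (intro qpoch_LIMSEQ q2)
  have "(\<lambda>n. (\<Prod>i\<le>n. 1 - w * q ^ i) * (\<Prod>i\<le>n. 1 - (- w) * q ^ i)) \<longlonglongrightarrow> qpoch w q * qpoch (- w) q"
    by (intro tendsto_mult qpoch_LIMSEQ assms)
  moreover have "(\<Prod>i\<le>n. 1 - w * q ^ i) * (\<Prod>i\<le>n. 1 - (- w) * q ^ i) =
      (\<Prod>i\<le>n. 1 - w\<^sup>2 * (q\<^sup>2) ^ i)" for n
  proof -
    have "(1 - w * q ^ i) * (1 - (- w) * q ^ i) = 1 - w\<^sup>2 * (q\<^sup>2) ^ i" for i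
      by (simp add: algebra_simps power2_eq_square power_mult_distrib)
    then show ?thesis
      by (simp only: prod.distrib [symmetric])
  qed
  ultimately show "(\<lambda>n. \<Prod>i\<le>n. 1 - w\<^sup>2 * (q\<^sup>2) ^ i) \<longlonglongrightarrow> qpoch w q * qpoch (- w) q"
    by simp
qed

text \<open>Euler's identity between partitions into distinct parts and into odd parts. Splitting
  \<open>qpoch q q\<close> by the parity of the exponents and factoring
  \<open>qpoch (q^2) (q^2)\<close> by differences of squares leaves a nonzero factor
  \<open>qpoch q q\<close> to cancel. The identity removes the infinite products that occur at the
  2-torsion points.\<close>

lemma euler_qpoch_identity:
  assumes "norm q < 1"
  shows "qpoch (- q) q * qpoch q (q\<^sup>2) = 1"
proof -
  have "qpoch q q = qpoch q (q\<^sup>2) * qpoch (q\<^sup>2) (q\<^sup>2)"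
    using qpoch_even_odd[OF assms, of q] by (simp add: power2_eq_square)
  also have "qpoch (q\<^sup>2) (q\<^sup>2) = qpoch q q * qpoch (- q) q"
    by (rule qpoch_square[OF assms])
  finally show ?thesis
    using qpoch_q_nonzero[OF assms] by (simp add: mult.commute)
qed

section \<open>Quasi-periodic entire functions\<close>

text \<open>The codomain is arbitrary so that the lemma also applies to predicates such as
  \<open>\<lambda>z. G z = 0\<close>.\<close>

lemma invariant_int_multiple:
  fixes f :: "complex \<Rightarrow> 'a"
  assumes "\<And>z. f (z + w) = f z"
  shows "f (z + of_int m * w) = f z"
proof -
  have nat: "f (z + of_nat n * w) = f z" for z n
  proof (induction n)
    case (Suc n)
    have "z + of_nat (Suc n) * w = (z + of_nat n * w) + w"
      by (simp add: algebra_simps)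
    then show ?case
      using Suc by (simp only: assms)
  qed simp
  obtain n where "m = int n \<or> m = - int n"
    by (metis int_cases2)
  then show ?thesis
    using nat[of z n] nat[of "z - of_nat n * w" n] by auto
qed

text \<open>The quotient \<open>G / F\<close> extends to an elliptic function without poles, hence is constant by
  Liouville's theorem.\<close>

lemma quasi_periodic_proportional:
  fixes F G \<mu>1 \<mu>2 :: "complex \<Rightarrow> complex" and w1 w2 :: complex
  assumes hol: "F holomorphic_on UNIV" "G holomorphic_on UNIV"
    and zero: "F 0 = 0" "G 0 = 0"
    and der: "(F has_field_derivative F') (at 0)" "F' \<noteq> 0" "(G has_field_derivative G') (at 0)"
    and zeros: "\<And>z. F z = 0 \<Longrightarrow> \<exists>m n. z = of_int m * w1 + of_int n * w2"
    and F1: "\<And>z. F (z + w1) = \<mu>1 z * F z" and G1: "\<And>z. G (z + w1) = \<mu>1 z * G z"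
    and F2: "\<And>z. F (z + w2) = \<mu>2 z * F z" and G2: "\<And>z. G (z + w2) = \<mu>2 z * G z"
    and \<mu>: "\<And>z. \<mu>1 z \<noteq> 0" "\<And>z. \<mu>2 z \<noteq> 0"
    and basis: "\<And>z. \<exists>x y :: real. z = of_real x * w1 + of_real y * w2"
  shows "G z * F' = F z * G'"
proof -
  \<comment> \<open>The zeros of \<open>F\<close> lie on the lattice, where \<open>G\<close>
    vanishes too. The value \<open>G' / F'\<close> is the limit of the quotient at \<open>0\<close>,
    so that all singularities of \<open>H\<close> turn out to be removable.\<close>
  define H where "H z = (if F z = 0 then G' / F' else G z / F z)" for z
  have H1: "H (z + w1) = H z" and H2: "H (z + w2) = H z" for z
    using \<mu> by (auto simp: H_def F1 F2 G1 G2)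
  have H_lattice: "H (z + (of_int m * w1 + of_int n * w2)) = H z" for z m n
    using invariant_int_multiple[of H w1, OF H1] invariant_int_multiple[of H w2, OF H2]
    by (simp add: add.assoc [symmetric])
  have contF: "continuous_on UNIV F"
    using hol(1) by (rule holomorphic_on_imp_continuous_on)
  have openF: "open {z. F z \<noteq> 0}"
    using contF by (intro open_Collect_neq) auto
  have diff_nz: "H field_differentiable (at z)" if "F z \<noteq> 0" for z
  proof -
    have "(\<lambda>z. G z / F z) holomorphic_on {z. F z \<noteq> 0}"
      using hol by (intro holomorphic_intros) (auto elim: holomorphic_on_subset)
    then have "H holomorphic_on {z. F z \<noteq> 0}"
      by (rule holomorphic_transform) (auto simp: H_def)
    then show ?thesis
      using openF that by (auto intro: holomorphic_on_imp_differentiable_at)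
  qed
  have lim: "((\<lambda>z. G z / F z) \<longlongrightarrow> G' / F') (at 0)"
  proof -
    have "((\<lambda>z. (G z / z) / (F z / z)) \<longlongrightarrow> G' / F') (at 0)"
      using der zero by (intro tendsto_divide) (auto simp: has_field_derivative_iff)
    moreover have "\<forall>\<^sub>F z in at 0. (G z / z) / (F z / z) = G z / F z"
      by (auto simp: eventually_at_filter)
    ultimately show ?thesis
      by (rule Lim_transform_eventually)
  qed
  have ev_nz: "\<forall>\<^sub>F z in at 0. F z \<noteq> 0"
  proof -
    have "((\<lambda>z. F z / z) \<longlongrightarrow> F') (at 0)"
      using der(1) zero(1) by (simp add: has_field_derivative_iff)
    then have "\<forall>\<^sub>F z in at 0. F z / z \<noteq> 0"
      using der(2) by (rule tendsto_imp_eventually_ne)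
    then show ?thesis
      by eventually_elim auto
  qed
  have diff_0: "H field_differentiable (at 0)"
  proof -
    obtain e where e: "e > 0" "\<And>z. z \<noteq> 0 \<Longrightarrow> dist z 0 < e \<Longrightarrow> F z \<noteq> 0"
      using ev_nz by (auto simp: eventually_at)
    have "H holomorphic_on ball 0 e"
    proof (rule no_isolated_singularity')
      fix z :: complex assume "z \<in> {0}"
      have "(H \<longlongrightarrow> G' / F') (at 0)"
        using lim by (rule Lim_transform_eventually)
          (use ev_nz in eventually_elim, auto simp: H_def)
      then have "(H \<longlongrightarrow> G' / F') (at 0 within ball 0 e)"
        by (rule tendsto_within_subset) simp
      moreover have "z = 0" "H 0 = G' / F'"
        using \<open>z \<in> {0}\<close> zero by (simp_all add: H_def)
      ultimately show "(H \<longlongrightarrow> H z) (at z within ball 0 e)"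
        by simp
    next
      show "H holomorphic_on ball 0 e - {0}"
        unfolding holomorphic_on_def
      proof
        fix u :: complex assume "u \<in> ball 0 e - {0}"
        then have "F u \<noteq> 0"
          using e(2) by (simp add: dist_commute)
        then show "H field_differentiable at u within ball 0 e - {0}"
          using diff_nz by (blast intro: field_differentiable_at_within)
      qed
    qed auto
    then show ?thesis
      using e(1) by (auto intro: holomorphic_on_imp_differentiable_at[of _ "ball 0 e"])
  qed
  have holH: "H holomorphic_on UNIV"
    unfolding holomorphic_on_def
  proof
    fix z :: complex
    show "H field_differentiable (at z within UNIV)"
    proof (cases "F z = 0")
      case True
      then obtain m n where z: "z = of_int m * w1 + of_int n * w2"
        using zeros by blast
      \<comment> \<open>At an arbitrary zero of \<open>F\<close> the singularity is moved to
        \<open>0\<close> by the lattice periodicity of \<open>H\<close>.\<close>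
      have "(H \<circ> (\<lambda>u. u - z)) field_differentiable (at z)"
        using diff_0 by (intro field_differentiable_compose) (auto intro!: derivative_intros)
      moreover have "H \<circ> (\<lambda>u. u - z) = H"
        using H_lattice[of "_ - z" m n] by (auto simp: fun_eq_iff z)
      ultimately show ?thesis
        by simp
    qed (use diff_nz in auto)
  qed
  \<comment> \<open>Reducing both real coordinates modulo 1 shows that every value is attained on
    the closed fundamental parallelogram, which is compact.\<close>
  have "range H \<subseteq> H ` ((\<lambda>(x, y). of_real x * w1 + of_real y * w2) ` ({0..1} \<times> {0..1 :: real}))"
  proof safe
    fix z
    obtain x y :: real where xy: "z = of_real x * w1 + of_real y * w2"
      using basis by blast
    have "H z = H (of_real (frac x) * w1 + of_real (frac y) * w2)"
      using H_lattice[of "of_real (frac x) * w1 + of_real (frac y) * w2" "\<lfloor>x\<rfloor>" "\<lfloor>y\<rfloor>"]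
      by (simp add: xy frac_def algebra_simps)
    then show "H z \<in> H ` ((\<lambda>(x, y). of_real x * w1 + of_real y * w2) ` ({0..1} \<times> {0..1 :: real}))"
      using frac_lt_1[of x] frac_lt_1[of y]
      by (intro image_eqI[of _ _ "of_real (frac x) * w1 + of_real (frac y) * w2"]
          image_eqI[of _ _ "(frac x, frac y)"]) auto
  qed
  moreover have "compact (H ` ((\<lambda>(x, y). of_real x * w1 + of_real y * w2) ` ({0..1} \<times> {0..1 :: real})))"
    using holomorphic_on_imp_continuous_on[OF holH]
    by (intro compact_continuous_image) (auto simp: case_prod_unfold
        intro!: continuous_intros compact_Times elim: continuous_on_subset)
  ultimately have "bounded (range H)"
    using bounded_subset compact_imp_bounded by blast
  then have "H constant_on UNIV"
    using Liouville_theorem holH by blast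
  then have "H z = H 0"
    by (auto simp: constant_on_def)
  then have Hz: "H z = G' / F'"
    by (simp add: H_def zero)
  show ?thesis
  proof (cases "F z = 0")
    case True
    then obtain m n where z: "z = of_int m * w1 + of_int n * w2"
      using zeros by blast
    \<comment> \<open>At a zero of \<open>F\<close> the value of \<open>H\<close> says nothing about
      \<open>G\<close>. There \<open>G\<close> vanishes because \<open>G 0 = 0\<close> and the
      nonzero multipliers make its zero set invariant under the lattice.\<close>
    have "(G (z + w1) = 0) = (G z = 0)" "(G (z + w2) = 0) = (G z = 0)" for z
      using \<mu> by (auto simp: G1 G2)
    note this[THEN invariant_int_multiple[of "\<lambda>z. G z = 0"]]
    from this(1)[of 0 m] this(2)[of "of_int m * w1" n] have "G z = 0"
      using zero by (simp add: z)
    then show ?thesis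
      using True by simp
  next
    case False
    then show ?thesis
      using Hz der(2) by (simp add: H_def field_simps)
  qed
qed

section \<open>The normalised theta function\<close>

definition e2pi :: "complex \<Rightarrow> complex" where
  "e2pi z = exp (2 * pi * \<i> * z)"

lemma e2pi_add: "e2pi (x + y) = e2pi x * e2pi y"
  by (simp add: e2pi_def algebra_simps exp_add)

lemma e2pi_0 [simp]: "e2pi 0 = 1"
  by (simp add: e2pi_def)

lemma e2pi_nonzero [simp]: "e2pi z \<noteq> 0"
  by (simp add: e2pi_def)

lemma e2pi_minus: "e2pi (- z) = inverse (e2pi z)"
  by (simp add: e2pi_def exp_minus)

lemma e2pi_diff: "e2pi (x - y) = e2pi x / e2pi y"
  by (simp add: e2pi_def algebra_simps exp_diff)

lemma e2pi_power: "e2pi z ^ n = e2pi (of_nat n * z)"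
  by (simp add: e2pi_def exp_of_nat_mult [symmetric] mult_ac)

lemma e2pi_eq_1_iff: "e2pi z = 1 \<longleftrightarrow> (\<exists>n. z = of_int n)"
proof -
  have "e2pi z = 1 \<longleftrightarrow> (\<exists>n::int. Re z = of_int n \<and> Im z = 0)"
    by (auto simp: e2pi_def exp_eq_1 mult_ac)
  then show ?thesis
    by (auto simp: complex_eq_iff)
qed

lemma e2pi_of_int [simp]: "e2pi (of_int n) = 1"
  by (auto simp: e2pi_eq_1_iff)

lemma e2pi_1 [simp]: "e2pi 1 = 1"
  using e2pi_of_int[of 1] by (simp del: e2pi_of_int)

lemma e2pi_half [simp]: "e2pi (1 / 2) = - 1"
  by (simp add: e2pi_def)

lemma e2pi_cong:
  assumes "x - y = of_int n"
  shows "e2pi x = e2pi y"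
proof -
  have "e2pi x = e2pi y * e2pi (x - y)"
    by (simp add: e2pi_add [symmetric])
  then show ?thesis
    by (simp add: assms)
qed

lemma norm_e2pi_less_1:
  assumes "Im \<tau> > 0"
  shows "norm (e2pi \<tau>) < 1"
  using assms by (simp add: e2pi_def norm_exp_eq_Re)

text \<open>Up to a constant factor this is \<open>\<theta>\<^sub>1(z|\<tau>) / \<eta>(\<tau>)\<^sup>3\<close>. Its derivative at \<open>0\<close> does not depend on \<open>\<tau>\<close>,
  which is why its transformation law involves no root of unity.\<close>

definition theta_phi :: "complex \<Rightarrow> complex \<Rightarrow> complex" where
  "theta_phi \<tau> z = e2pi (- z / 2) * qpoch (e2pi z) (e2pi \<tau>) * qpoch (e2pi (\<tau> - z)) (e2pi \<tau>)
     / qpoch (e2pi \<tau>) (e2pi \<tau>) ^ 2"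

section \<open>Zeros, quasi-periods and derivative of the theta function\<close>

context
  fixes \<tau> :: complex
  assumes Im_pos: "Im \<tau> > 0"
begin

text \<open>Pulling out the factor that vanishes at \<open>0\<close> leaves two products that are
  exchanged by \<open>z \<mapsto> - z\<close>. Oddness and the derivative at \<open>0\<close> are
  read off from this form.\<close>

lemma theta_phi_split:
  "theta_phi \<tau> z = (1 - e2pi z) * (e2pi (- z / 2) * qpoch (e2pi (\<tau> + z)) (e2pi \<tau>) *
     qpoch (e2pi (\<tau> - z)) (e2pi \<tau>) / qpoch (e2pi \<tau>) (e2pi \<tau>) ^ 2)"
  using qpoch_rec[OF norm_e2pi_less_1[OF Im_pos], of "e2pi z"]
  by (simp add: theta_phi_def e2pi_add mult_ac)

lemma theta_phi_0 [simp]: "theta_phi \<tau> 0 = 0"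
  by (simp add: theta_phi_split)

lemma theta_phi_minus: "theta_phi \<tau> (- z) = - theta_phi \<tau> z"
proof -
  have "(1 - e2pi (- z)) * e2pi (z / 2) = - (1 - e2pi z) * e2pi (- z / 2)"
    using e2pi_add[of "z / 2" "z / 2"] by (simp add: e2pi_minus field_simps)
  then have eq: "(1 - e2pi (- z)) * e2pi (z / 2) * R = - ((1 - e2pi z) * e2pi (- z / 2) * R)" for R
    by (simp only: mult_minus_left)
  have "theta_phi \<tau> (- z) = (1 - e2pi (- z)) * e2pi (z / 2) *
      (qpoch (e2pi (\<tau> + z)) (e2pi \<tau>) * qpoch (e2pi (\<tau> - z)) (e2pi \<tau>) /
       qpoch (e2pi \<tau>) (e2pi \<tau>) ^ 2)"
    by (simp add: theta_phi_split mult_ac)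
  also have "\<dots> = - theta_phi \<tau> z"
    unfolding eq theta_phi_split[of z] by simp
  finally show ?thesis .
qed

lemma theta_phi_plus_1: "theta_phi \<tau> (z + 1) = - theta_phi \<tau> z"
proof -
  have "e2pi (- (z + 1) / 2) = - e2pi (- z / 2)"
  proof -
    have "- (z + 1) / 2 = - z / 2 - 1 / 2"
      by (simp add: field_simps)
    then show ?thesis
      by (simp only: e2pi_diff e2pi_half) simp
  qed
  moreover have "e2pi (z + 1) = e2pi z" "e2pi (\<tau> - (z + 1)) = e2pi (\<tau> - z)"
    by (simp_all add: e2pi_add e2pi_diff)
  ultimately show ?thesis
    by (simp add: theta_phi_def)
qed

text \<open>The sign is written as \<open>e2pi (1 / 2)\<close> so that the multipliers of repeated
  shifts combine by adding exponents.\<close>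

lemma theta_phi_plus_tau: "theta_phi \<tau> (z + \<tau>) = e2pi (1 / 2 - \<tau> / 2 - z) * theta_phi \<tau> z"
proof -
  define R where "R = qpoch (e2pi (\<tau> + z)) (e2pi \<tau>) * qpoch (e2pi (\<tau> - z)) (e2pi \<tau>) /
    qpoch (e2pi \<tau>) (e2pi \<tau>) ^ 2"
  have "theta_phi \<tau> (z + \<tau>) = e2pi (- (z + \<tau>) / 2) * (1 - e2pi (- z)) * R"
    using qpoch_rec[OF norm_e2pi_less_1[OF Im_pos], of "e2pi (- z)"]
    by (simp add: theta_phi_def R_def add_ac e2pi_add [symmetric])
  also have "e2pi (- (z + \<tau>) / 2) * (1 - e2pi (- z)) =
      e2pi (1 / 2 - \<tau> / 2 - z) * ((1 - e2pi z) * e2pi (- z / 2))"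
  proof -
    have 1: "e2pi (- (z + \<tau>) / 2) = e2pi (- (\<tau> / 2)) * e2pi (- z / 2)"
      by (simp add: e2pi_add [symmetric] diff_divide_distrib algebra_simps)
    have 2: "e2pi (1 / 2 - \<tau> / 2 - z) = - (e2pi (- (\<tau> / 2)) * e2pi (- z))"
      unfolding e2pi_diff e2pi_half e2pi_minus by (simp add: divide_simps)
    have "e2pi (- z) * e2pi z = 1"
      by (simp add: e2pi_minus)
    then show ?thesis
      unfolding 1 2 by (simp add: algebra_simps)
  qed
  also have "\<dots> * R = e2pi (1 / 2 - \<tau> / 2 - z) * theta_phi \<tau> z"
    by (simp add: theta_phi_split R_def)
  finally show ?thesis .
qed

lemma theta_phi_plus_int: "theta_phi \<tau> (z + of_int n) = e2pi (of_int n / 2) * theta_phi \<tau> z"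
proof (induction n arbitrary: z rule: int_induct[where k = 0])
  case (step1 i)
  have "theta_phi \<tau> (z + of_int (i + 1)) = - theta_phi \<tau> (z + of_int i)"
    using theta_phi_plus_1[of "z + of_int i"] by (simp add: add_ac)
  then show ?case
    by (simp add: step1 add_divide_distrib e2pi_add)
next
  case (step2 i)
  have "theta_phi \<tau> (z + of_int i) = - theta_phi \<tau> (z + of_int (i - 1))"
    using theta_phi_plus_1[of "z + of_int (i - 1)"] by (simp add: add_ac)
  then show ?case
    using step2 by (simp add: diff_divide_distrib e2pi_diff minus_equation_iff)
qed simp

text \<open>Repeated shifts by \<open>\<tau>\<close> add up an arithmetic progression of exponents,
  which produces the term quadratic in \<open>m\<close>.\<close>

lemma theta_phi_plus_int_tau:
  "theta_phi \<tau> (z + of_int m * \<tau>) =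
     e2pi (of_int m / 2 - of_int m ^ 2 * \<tau> / 2 - of_int m * z) * theta_phi \<tau> z"
proof (induction m arbitrary: z rule: int_induct[where k = 0])
  case (step1 i)
  have "theta_phi \<tau> (z + of_int (i + 1) * \<tau>) =
      e2pi (1 / 2 - \<tau> / 2 - (z + of_int i * \<tau>)) * theta_phi \<tau> (z + of_int i * \<tau>)"
    using theta_phi_plus_tau[of "z + of_int i * \<tau>"] by (simp add: algebra_simps)
  also have "\<dots> = e2pi (1 / 2 - \<tau> / 2 - (z + of_int i * \<tau>) +
      (of_int i / 2 - of_int i ^ 2 * \<tau> / 2 - of_int i * z)) * theta_phi \<tau> z"
    by (simp add: step1 e2pi_add)
  also have "1 / 2 - \<tau> / 2 - (z + of_int i * \<tau>) + (of_int i / 2 - of_int i ^ 2 * \<tau> / 2 - of_int i * z)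
      = of_int (i + 1) / 2 - of_int (i + 1) ^ 2 * \<tau> / 2 - of_int (i + 1) * z"
    by (simp add: field_simps power2_eq_square)
  finally show ?case .
next
  case (step2 i)
  let ?E = "1 / 2 - \<tau> / 2 - (z + of_int (i - 1) * \<tau>)"
  have "theta_phi \<tau> (z + of_int i * \<tau>) = e2pi ?E * theta_phi \<tau> (z + of_int (i - 1) * \<tau>)"
    using theta_phi_plus_tau[of "z + of_int (i - 1) * \<tau>"] by (simp add: algebra_simps)
  then have "theta_phi \<tau> (z + of_int (i - 1) * \<tau>) = e2pi (- ?E) * theta_phi \<tau> (z + of_int i * \<tau>)"
    unfolding e2pi_minus by (simp add: field_simps)
  also have "\<dots> = e2pi (- ?E + (of_int i / 2 - of_int i ^ 2 * \<tau> / 2 - of_int i * z)) * theta_phi \<tau> z"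
    unfolding e2pi_add step2 by simp
  also have "- ?E + (of_int i / 2 - of_int i ^ 2 * \<tau> / 2 - of_int i * z)
      = of_int (i - 1) / 2 - of_int (i - 1) ^ 2 * \<tau> / 2 - of_int (i - 1) * z"
    by (simp add: field_simps power2_eq_square)
  finally show ?case .
qed simp

lemma theta_phi_plus_lattice:
  "theta_phi \<tau> (z + of_int m * \<tau> + of_int n) =
     e2pi ((of_int m + of_int n) / 2 - of_int m ^ 2 * \<tau> / 2 - of_int m * z) * theta_phi \<tau> z"
proof -
  have "e2pi ((of_int m + of_int n) / 2 - of_int m ^ 2 * \<tau> / 2 - of_int m * z) =
      e2pi (of_int n / 2) * e2pi (of_int m / 2 - of_int m ^ 2 * \<tau> / 2 - of_int m * z)"
    by (simp add: e2pi_add [symmetric] add_divide_distrib algebra_simps)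
  then show ?thesis
    by (simp only: theta_phi_plus_int theta_phi_plus_int_tau mult.assoc)
qed

lemma theta_phi_eq_0D:
  assumes "theta_phi \<tau> z = 0"
  shows "\<exists>m n. z = of_int m * \<tau> + of_int n"
proof -
  note q = norm_e2pi_less_1[OF Im_pos]
  have "qpoch (e2pi z) (e2pi \<tau>) = 0 \<or> qpoch (e2pi (\<tau> - z)) (e2pi \<tau>) = 0"
    using assms qpoch_q_nonzero[OF q] by (auto simp: theta_phi_def)
  then consider k where "e2pi (z + of_nat k * \<tau>) = 1" | k where "e2pi (\<tau> - z + of_nat k * \<tau>) = 1"
    by (auto simp: qpoch_eq_0_iff[OF q] e2pi_power e2pi_add)
  then show ?thesis
  proof cases
    case (1 k)
    then obtain n where "z + of_nat k * \<tau> = of_int n"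
      by (auto simp: e2pi_eq_1_iff)
    then have "z = of_int (- int k) * \<tau> + of_int n"
      by (simp add: algebra_simps)
    then show ?thesis by blast
  next
    case (2 k)
    then obtain n where "\<tau> - z + of_nat k * \<tau> = of_int n"
      by (auto simp: e2pi_eq_1_iff)
    then have "z = of_int (int k + 1) * \<tau> + of_int (- n)"
      by (simp add: algebra_simps)
    then show ?thesis by blast
  qed
qed

lemma holomorphic_qpoch_e2pi:
  assumes "f holomorphic_on A"
  shows "(\<lambda>z. qpoch (e2pi (f z)) (e2pi \<tau>)) holomorphic_on A"
proof -
  have "(\<lambda>z. e2pi (f z)) holomorphic_on A"
    unfolding e2pi_def by (intro holomorphic_intros assms)
  from holomorphic_on_compose_gen[OF this holomorphic_qpoch[OF norm_e2pi_less_1[OF Im_pos]]]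
  show ?thesis
    by (simp add: o_def)
qed

lemma holomorphic_theta_phi: "theta_phi \<tau> holomorphic_on UNIV"
proof -
  have "(\<lambda>z. e2pi (- z / 2)) holomorphic_on UNIV"
    unfolding e2pi_def by (intro holomorphic_intros) auto
  moreover have "(\<lambda>z. qpoch (e2pi z) (e2pi \<tau>)) holomorphic_on UNIV"
    "(\<lambda>z. qpoch (e2pi (\<tau> - z)) (e2pi \<tau>)) holomorphic_on UNIV"
    by (intro holomorphic_qpoch_e2pi holomorphic_intros)+
  ultimately show ?thesis
    unfolding theta_phi_def [abs_def]
    using qpoch_q_nonzero[OF norm_e2pi_less_1[OF Im_pos]]
    by (intro holomorphic_on_divide holomorphic_on_mult holomorphic_on_const) auto
qed

text \<open>At \<open>z = 0\<close> the two remaining products both become \<open>qpoch q q\<close>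
  with \<open>q = e2pi \<tau>\<close>, and the denominator of \<open>theta_phi\<close> cancels them.
  Only the derivative of \<open>1 - e2pi z\<close> survives.\<close>

lemma has_field_derivative_theta_phi_0: "(theta_phi \<tau> has_field_derivative - (2 * pi * \<i>)) (at 0)"
proof -
  define K where "K z = e2pi (- z / 2) * qpoch (e2pi (\<tau> + z)) (e2pi \<tau>) *
    qpoch (e2pi (\<tau> - z)) (e2pi \<tau>) / qpoch (e2pi \<tau>) (e2pi \<tau>) ^ 2" for z
  note nz = qpoch_q_nonzero[OF norm_e2pi_less_1[OF Im_pos]]
  have "K holomorphic_on UNIV"
  proof -
    have "(\<lambda>z. e2pi (- z / 2)) holomorphic_on UNIV"
      unfolding e2pi_def by (intro holomorphic_intros) auto
    moreover have "(\<lambda>z. qpoch (e2pi (\<tau> + z)) (e2pi \<tau>)) holomorphic_on UNIV"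
      "(\<lambda>z. qpoch (e2pi (\<tau> - z)) (e2pi \<tau>)) holomorphic_on UNIV"
      by (intro holomorphic_qpoch_e2pi holomorphic_intros)+
    ultimately show ?thesis
      unfolding K_def [abs_def] using nz
      by (intro holomorphic_on_divide holomorphic_on_mult holomorphic_on_const) auto
  qed
  then obtain K' where K': "(K has_field_derivative K') (at 0)"
    by (auto simp: holomorphic_on_def field_differentiable_def)
  have "K 0 = 1"
    using nz by (simp add: K_def power2_eq_square)
  have "((\<lambda>z. (1 - e2pi z) * K z) has_field_derivative - (2 * pi * \<i>)) (at 0)"
    unfolding e2pi_def by (rule derivative_eq_intros K' refl | simp add: \<open>K 0 = 1\<close>)+
  then show ?thesis
    by (simp add: K_def theta_phi_split [abs_def])
qed

end

section \<open>Modular transformation of the theta function\<close>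

lemma Im_moebius_pos:
  fixes a b c d :: int
  assumes "Im \<tau> > 0" "a * d - b * c = 1"
  shows "of_int c * \<tau> + of_int d \<noteq> 0" "Im ((of_int a * \<tau> + of_int b) / (of_int c * \<tau> + of_int d)) > 0"
proof -
  show nz: "of_int c * \<tau> + of_int d \<noteq> 0"
  proof
    assume "of_int c * \<tau> + of_int d = 0"
    then have "real_of_int c * Im \<tau> = 0" "real_of_int c * Re \<tau> + real_of_int d = 0"
      by (simp_all add: complex_eq_iff)
    then have "c = 0" "d = 0"
      using assms(1) by auto
    then show False
      using assms(2) by simp
  qed
  have "real_of_int a * real_of_int d - real_of_int b * real_of_int c = 1"
    using assms(2) by (metis of_int_1 of_int_diff of_int_mult)
  \<comment> \<open>The imaginary part of a quotient has the sign of that of the numerator times the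
    conjugate denominator; the determinant reduces the latter to \<open>Im \<tau>\<close>.\<close>
  then have "Im \<tau> = Im ((of_int a * \<tau> + of_int b) * cnj (of_int c * \<tau> + of_int d))"
    by (simp add: algebra_simps)
  then show "Im ((of_int a * \<tau> + of_int b) / (of_int c * \<tau> + of_int d)) > 0"
    using assms(1) by (simp only: Im_complex_div_gt_0)
qed

text \<open>Describes how the Gaussian exponent of the modular law changes when \<open>z\<close> is
  shifted by \<open>J * t\<close>. It is applied with \<open>t = 1\<close> and
  \<open>t = \<tau>'\<close>, which give the two generators of the lattice.\<close>

lemma complete_square:
  fixes c z J :: complex
  assumes "J \<noteq> 0"
  shows "c * (z + J * t)\<^sup>2 / (2 * J) = c * z\<^sup>2 / (2 * J) + c * z * t + c * J * t\<^sup>2 / 2"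
proof -
  have "c * (z + J * t)\<^sup>2 = c * z\<^sup>2 + (c * z * t) * (2 * J) + (c * J * t\<^sup>2 / 2) * (2 * J)"
    by (simp add: algebra_simps power2_eq_square)
  then show ?thesis
    using assms by (simp add: add_divide_distrib)
qed
text \<open>The numbers \<open>J\<close> and \<open>J * \<tau>'\<close> form a basis of the lattice
  spanned by \<open>1\<close> and \<open>\<tau>\<close>. Corrected by a Gaussian factor, the
  function at \<open>\<tau>'\<close> has the same multipliers along this basis as
  \<open>theta_phi \<tau>\<close>, so the two are proportional, and the derivatives at
  \<open>0\<close> fix the constant as \<open>1 / J\<close>.\<close>

lemma theta_phi_modular:
  fixes a b c d :: int
  assumes \<tau>: "Im \<tau> > 0" and det: "a * d - b * c = 1"
  defines "J \<equiv> of_int c * \<tau> + of_int d"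
  shows "J * theta_phi ((of_int a * \<tau> + of_int b) / J) (z / J) =
           e2pi (of_int c * z\<^sup>2 / (2 * J)) * theta_phi \<tau> z"
proof -
  define \<tau>' where "\<tau>' = (of_int a * \<tau> + of_int b) / J"
  have J: "J \<noteq> 0" and \<tau>': "Im \<tau>' > 0"
    using Im_moebius_pos[OF \<tau> det] by (simp_all add: J_def \<tau>'_def)
  have J\<tau>': "J * \<tau>' = of_int a * \<tau> + of_int b"
    using J by (simp add: \<tau>'_def)
  have det': "of_int a * of_int d - of_int b * of_int c = (1 :: complex)"
    using det by (metis of_int_1 of_int_diff of_int_mult)
  define G where "G z = e2pi (- (of_int c * z\<^sup>2 / (2 * J))) * theta_phi \<tau>' (z / J)" for z
  have "odd (a * d - b * c)"
    using det by simp
  then have par: "odd a \<or> odd b" "odd c \<or> odd d"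
    by auto

  have "G z * (- (2 * pi * \<i>)) = theta_phi \<tau> z * (- (2 * pi * \<i>) / J)"
  proof (rule quasi_periodic_proportional[where F = "theta_phi \<tau>" and G = G
        and ?w1.0 = J and ?w2.0 = "J * \<tau>'"])
    show "theta_phi \<tau> holomorphic_on UNIV"
      by (rule holomorphic_theta_phi[OF \<tau>])
    have "(\<lambda>z. theta_phi \<tau>' (z / J)) holomorphic_on UNIV"
    proof -
      have "(\<lambda>z. z / J) holomorphic_on UNIV"
        using J by (intro holomorphic_intros) auto
      from holomorphic_on_compose_gen[OF this holomorphic_theta_phi[OF \<tau>']] show ?thesis
        by (simp add: o_def)
    qed
    then show "G holomorphic_on UNIV"
      unfolding G_def [abs_def] e2pi_def using J by (intro holomorphic_intros) auto
    show "theta_phi \<tau> 0 = 0" "G 0 = 0"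
      using \<tau> \<tau>' by (simp_all add: G_def)
    show "(theta_phi \<tau> has_field_derivative - (2 * pi * \<i>)) (at 0)"
      by (rule has_field_derivative_theta_phi_0[OF \<tau>])
    have "((\<lambda>z. theta_phi \<tau>' (z / J)) has_field_derivative - (2 * pi * \<i>) * (1 / J)) (at 0)"
      by (rule DERIV_chain2[where f = "theta_phi \<tau>'"])
        (use has_field_derivative_theta_phi_0[OF \<tau>'] J in \<open>auto intro!: derivative_eq_intros\<close>)
    then show "(G has_field_derivative - (2 * pi * \<i>) / J) (at 0)"
      unfolding G_def e2pi_def using J \<tau>'
      by (auto intro!: derivative_eq_intros)
    show "\<exists>m n. z = of_int m * J + of_int n * (J * \<tau>')" if zero: "theta_phi \<tau> z = 0" for z
    proof -
      obtain m n where z: "z = of_int m * \<tau> + of_int n"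
        using theta_phi_eq_0D[OF \<tau> zero] by blast
      \<comment> \<open>The coefficients come from the inverse matrix, which expresses a lattice
        point in the basis \<open>J, J * \<tau>'\<close>.\<close>
      have "of_int (a * n - b * m) * J + of_int (d * m - c * n) * (J * \<tau>') =
          (of_int a * of_int d - of_int b * of_int c) * z"
        unfolding J\<tau>' by (simp add: J_def z algebra_simps)
      then show ?thesis
        using det' by (metis mult_1)
    qed
    show "theta_phi \<tau> (z + J) =
        e2pi ((of_int c + of_int d) / 2 - of_int c ^ 2 * \<tau> / 2 - of_int c * z) * theta_phi \<tau> z" for z
      using theta_phi_plus_lattice[OF \<tau>, of z c d] by (simp add: J_def add.assoc)
    show "theta_phi \<tau> (z + J * \<tau>') =
        e2pi ((of_int a + of_int b) / 2 - of_int a ^ 2 * \<tau> / 2 - of_int a * z) * theta_phi \<tau> z" for z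
      using theta_phi_plus_lattice[OF \<tau>, of z a b] by (simp add: J\<tau>' add.assoc)
    show "G (z + J) =
        e2pi ((of_int c + of_int d) / 2 - of_int c ^ 2 * \<tau> / 2 - of_int c * z) * G z" for z
    proof -
      \<comment> \<open>The determinant is odd, so \<open>c\<close> and \<open>d\<close> are not
        both even and \<open>t\<close> is an integer. The exponents of the two multipliers differ by
        exactly \<open>1 - t\<close>.\<close>
      have "even ((c + 1) * (d + 1))"
        using par by auto
      then obtain t where "(c + 1) * (d + 1) = 2 * t" ..
      then have "of_int ((c + 1) * (d + 1)) = (of_int (2 * t) :: complex)"
        by simp
      then have t: "(of_int t :: complex) = (of_int c * of_int d + of_int c + of_int d + 1) / 2"
        by (simp add: algebra_simps)
      have "G (z + J) = e2pi (- (of_int c * (z + J)\<^sup>2 / (2 * J)) + 1 / 2) * theta_phi \<tau>' (z / J)"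
        unfolding G_def e2pi_add e2pi_half
        using J theta_phi_plus_1[OF \<tau>', of "z / J"] by (simp add: add_divide_distrib)
      also have "e2pi (- (of_int c * (z + J)\<^sup>2 / (2 * J)) + 1 / 2) =
          e2pi ((of_int c + of_int d) / 2 - of_int c ^ 2 * \<tau> / 2 - of_int c * z +
            (- (of_int c * z\<^sup>2 / (2 * J))))"
      proof (rule e2pi_cong)
        have 1: "of_int c * (z + J)\<^sup>2 / (2 * J) = of_int c * z\<^sup>2 / (2 * J) + of_int c * z + of_int c * J / 2"
          using complete_square[OF J, of "of_int c" z 1] by simp
        have 2: "of_int c * J / 2 = of_int c ^ 2 * \<tau> / 2 + of_int c * of_int d / 2"
          by (simp add: J_def field_simps power2_eq_square)
        show "- (of_int c * (z + J)\<^sup>2 / (2 * J)) + 1 / 2 -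
          ((of_int c + of_int d) / 2 - of_int c ^ 2 * \<tau> / 2 - of_int c * z +
            (- (of_int c * z\<^sup>2 / (2 * J)))) = of_int (1 - t)"
          unfolding 1 2 of_int_diff t by (simp add: diff_divide_distrib add_divide_distrib)
      qed
      finally show ?thesis
        by (simp only: G_def[of z] e2pi_add mult.assoc)
    qed
    show "G (z + J * \<tau>') =
        e2pi ((of_int a + of_int b) / 2 - of_int a ^ 2 * \<tau> / 2 - of_int a * z) * G z" for z
    proof -
      have "even ((a + 1) * (b + 1))"
        using par by auto
      then obtain t where "(a + 1) * (b + 1) = 2 * t" ..
      then have "of_int ((a + 1) * (b + 1)) = (of_int (2 * t) :: complex)"
        by simp
      then have t: "(of_int t :: complex) = (of_int a * of_int b + of_int a + of_int b + 1) / 2"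
        by (simp add: algebra_simps)
      \<comment> \<open>This form of the determinant condition collapses both the part of the
        exponent linear in \<open>z\<close> and the constant part.\<close>
      have a: "of_int c * \<tau>' + 1 / J = of_int a"
      proof -
        have "(of_int c * \<tau>' + 1 / J) * J = of_int c * (J * \<tau>') + 1"
          using J by (simp add: distrib_right)
        also have "\<dots> = of_int c * (of_int a * \<tau> + of_int b) +
            (of_int a * of_int d - of_int b * of_int c)"
          unfolding J\<tau>' det' ..
        also have "\<dots> = of_int a * J"
          by (simp add: J_def algebra_simps)
        finally have "(of_int c * \<tau>' + 1 / J) * J = of_int a * J" .
        then show ?thesis
          using J by simp
      qed
      have "G (z + J * \<tau>') = e2pi (- (of_int c * (z + J * \<tau>')\<^sup>2 / (2 * J)) +
          (1 / 2 - \<tau>' / 2 - z / J)) * theta_phi \<tau>' (z / J)"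
        unfolding G_def e2pi_add
        using J theta_phi_plus_tau[OF \<tau>', of "z / J"] by (simp add: add_divide_distrib)
      also have "e2pi (- (of_int c * (z + J * \<tau>')\<^sup>2 / (2 * J)) + (1 / 2 - \<tau>' / 2 - z / J)) =
          e2pi ((of_int a + of_int b) / 2 - of_int a ^ 2 * \<tau> / 2 - of_int a * z +
            (- (of_int c * z\<^sup>2 / (2 * J))))"
      proof (rule e2pi_cong)
        have "of_int c * (z + J * \<tau>')\<^sup>2 / (2 * J) + \<tau>' / 2 + z / J =
            of_int c * z\<^sup>2 / (2 * J) + z * (of_int c * \<tau>' + 1 / J) +
            J * \<tau>' * (of_int c * \<tau>' + 1 / J) / 2"
        proof -
          have "z * (of_int c * \<tau>' + 1 / J) = of_int c * z * \<tau>' + z / J"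
            by (simp add: algebra_simps)
          moreover have "J * \<tau>' * (of_int c * \<tau>' + 1 / J) = of_int c * J * \<tau>'\<^sup>2 + \<tau>'"
            using J by (simp add: distrib_left power2_eq_square)
          ultimately show ?thesis
            unfolding complete_square[OF J] by (simp only: add_divide_distrib) simp
        qed
        also have "\<dots> = of_int c * z\<^sup>2 / (2 * J) + z * of_int a + of_int a ^ 2 * \<tau> / 2 +
            of_int a * of_int b / 2"
          unfolding a J\<tau>' by (simp add: field_simps power2_eq_square)
        finally have 1: "of_int c * (z + J * \<tau>')\<^sup>2 / (2 * J) = of_int c * z\<^sup>2 / (2 * J) + z * of_int a +
            of_int a ^ 2 * \<tau> / 2 + of_int a * of_int b / 2 - \<tau>' / 2 - z / J"
          by (simp add: algebra_simps)
        show "- (of_int c * (z + J * \<tau>')\<^sup>2 / (2 * J)) + (1 / 2 - \<tau>' / 2 - z / J) -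
          ((of_int a + of_int b) / 2 - of_int a ^ 2 * \<tau> / 2 - of_int a * z +
            (- (of_int c * z\<^sup>2 / (2 * J)))) = of_int (1 - t)"
          unfolding 1 of_int_diff t by (simp add: diff_divide_distrib add_divide_distrib)
      qed
      finally show ?thesis
        by (simp only: G_def[of z] e2pi_add mult.assoc)
    qed
    show "\<exists>x y :: real. z = of_real x * J + of_real y * (J * \<tau>')" for z
    proof -
      define y where "y = Im (z / J) / Im \<tau>'"
      define x where "x = Re (z / J) - y * Re \<tau>'"
      have "z / J = of_real x + of_real y * \<tau>'"
        using \<tau>' by (simp add: complex_eq_iff x_def y_def)
      then have "z = of_real x * J + of_real y * (J * \<tau>')"
        using J by (simp add: field_simps)
      then show ?thesis by blast
    qed
  qed auto
  then have "J * G z = theta_phi \<tau> z"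
    using J by (simp add: field_simps)
  then show ?thesis
    by (simp add: G_def \<tau>'_def e2pi_minus field_simps)
qed

section \<open>Klein forms and the discriminant\<close>

lemma dedekind_eta_eq: "dedekind_eta \<tau> = e2pi (\<tau> / 24) * qpoch (e2pi \<tau>) (e2pi \<tau>)"
  by (simp add: dedekind_eta_def e2pi_def qpoch_def)

lemma dedekind_eta_nonzero: "Im \<tau> > 0 \<Longrightarrow> dedekind_eta \<tau> \<noteq> 0"
  by (simp add: dedekind_eta_eq qpoch_q_nonzero norm_e2pi_less_1)

text \<open>Up to a constant factor, the Klein form with characteristic \<open>(x, y)\<close>. The
  prefactor is chosen to absorb the Gaussian factor in \<open>theta_phi_modular\<close>.\<close>

definition klein :: "complex \<Rightarrow> complex \<Rightarrow> complex \<Rightarrow> complex" where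
  "klein x y \<tau> = e2pi (x * (x * \<tau> + y) / 2) * theta_phi \<tau> (x * \<tau> + y)"

text \<open>With \<open>x'\<close> the first new characteristic, the determinant gives
  \<open>x + c * (J * z) = x' * J\<close>. This merges the Gaussian factor with the prefactor, so
  the matrix acts linearly on the characteristic and no multiplier remains.\<close>

lemma klein_modular:
  fixes a b c d :: int
  assumes \<tau>: "Im \<tau> > 0" and det: "a * d - b * c = 1"
  defines "J \<equiv> of_int c * \<tau> + of_int d"
  shows "J * klein x y ((of_int a * \<tau> + of_int b) / J) =
           klein (x * of_int a + y * of_int c) (x * of_int b + y * of_int d) \<tau>"
proof -
  define \<tau>' where "\<tau>' = (of_int a * \<tau> + of_int b) / J"
  define z where "z = x * \<tau>' + y"
  define x' where "x' = x * of_int a + y * of_int c"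
  define y' where "y' = x * of_int b + y * of_int d"
  have J: "J \<noteq> 0"
    using Im_moebius_pos[OF \<tau> det] by (simp add: J_def)
  have det': "of_int a * of_int d = 1 + of_int b * (of_int c :: complex)"
    using det by (metis add_diff_cancel_left' diff_add_cancel of_int_1 of_int_add of_int_mult)
  have Jz: "J * z = x' * \<tau> + y'"
  proof -
    have "J * z = x * (J * \<tau>') + y * J"
      by (simp add: z_def algebra_simps)
    also have "J * \<tau>' = of_int a * \<tau> + of_int b"
      using J by (simp add: \<tau>'_def)
    finally show ?thesis
      by (simp add: J_def x'_def y'_def algebra_simps)
  qed
  have *: "x + of_int c * (J * z) = x' * J"
  proof -
    have "x + of_int c * (J * z) = x * (1 + of_int b * of_int c) + of_int c * (x' * \<tau> + y * of_int d)"
      unfolding Jz by (simp add: y'_def algebra_simps)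
    also have "\<dots> = x' * J"
      unfolding det' [symmetric] by (simp add: J_def x'_def algebra_simps)
    finally show ?thesis .
  qed
  have "J * klein x y \<tau>' = e2pi (x * z / 2) * (J * theta_phi \<tau>' (J * z / J))"
    using J by (simp add: klein_def z_def)
  also have "J * theta_phi \<tau>' (J * z / J) = e2pi (of_int c * (J * z)\<^sup>2 / (2 * J)) * theta_phi \<tau> (J * z)"
    unfolding \<tau>'_def J_def by (rule theta_phi_modular[OF \<tau> det])
  also have "e2pi (x * z / 2) * (e2pi (of_int c * (J * z)\<^sup>2 / (2 * J)) * theta_phi \<tau> (J * z)) =
      e2pi (x * z / 2 + of_int c * (J * z)\<^sup>2 / (2 * J)) * theta_phi \<tau> (J * z)"
    by (simp add: e2pi_add)
  also have "x * z / 2 + of_int c * (J * z)\<^sup>2 / (2 * J) = (x + of_int c * (J * z)) * z / 2"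
    using J by (simp add: power2_eq_square field_simps)
  also have "\<dots> = x' * (J * z) / 2"
    unfolding * by (simp only: mult.assoc)
  finally show ?thesis
    unfolding Jz by (simp add: klein_def \<tau>'_def x'_def y'_def)
qed

text \<open>The prefactor cancels every term of the theta multiplier that involves
  \<open>\<tau>\<close>; what remains depends on the characteristics alone and is a root of unity
  when they are rational.\<close>

lemma klein_shift:
  assumes "Im \<tau> > 0"
  shows "klein (x + of_int m) (y + of_int n) \<tau> =
    e2pi ((of_int m * of_int n + of_int m + of_int n + x * of_int n - y * of_int m) / 2) * klein x y \<tau>"
proof -
  define z where "z = x * \<tau> + y"
  have "klein (x + of_int m) (y + of_int n) \<tau> =
      e2pi ((x + of_int m) * (z + of_int m * \<tau> + of_int n) / 2) * theta_phi \<tau> (z + of_int m * \<tau> + of_int n)"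
    by (simp add: klein_def z_def algebra_simps)
  also have "\<dots> = e2pi ((x + of_int m) * (z + of_int m * \<tau> + of_int n) / 2 +
      ((of_int m + of_int n) / 2 - of_int m ^ 2 * \<tau> / 2 - of_int m * z)) * theta_phi \<tau> z"
    unfolding theta_phi_plus_lattice[OF assms] e2pi_add by (simp only: mult.assoc)
  also have "(x + of_int m) * (z + of_int m * \<tau> + of_int n) / 2 +
      ((of_int m + of_int n) / 2 - of_int m ^ 2 * \<tau> / 2 - of_int m * z) =
      (of_int m * of_int n + of_int m + of_int n + x * of_int n - y * of_int m) / 2 + x * z / 2"
    by (simp add: z_def field_simps power2_eq_square)
  finally show ?thesis
    by (simp add: klein_def z_def e2pi_add)
qed

text \<open>Shifting a half-integral characteristic by integers changes the Klein form by a fourth root of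
  unity, so only the fourth power depends on the characteristic modulo \<open>1\<close>.\<close>

definition klein_half4 :: "int \<Rightarrow> int \<Rightarrow> complex \<Rightarrow> complex" where
  "klein_half4 m n \<tau> = klein (of_int m / 2) (of_int n / 2) \<tau> ^ 4"

lemma klein_half4_cong:
  assumes "Im \<tau> > 0" "even (m' - m)" "even (n' - n)"
  shows "klein_half4 m' n' \<tau> = klein_half4 m n \<tau>"
proof -
  obtain i where "m' - m = 2 * i"
    using assms(2) by (rule dvdE)
  moreover obtain j where "n' - n = 2 * j"
    using assms(3) by (rule dvdE)
  ultimately have ij: "m' = m + 2 * i" "n' = n + 2 * j"
    by linarith+
  define E where "E = (of_int i * of_int j + of_int i + of_int j + of_int m / 2 * of_int j - of_int n / 2 * of_int i) / (2 :: complex)"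
  have "klein (of_int m' / 2) (of_int n' / 2) \<tau> = e2pi E * klein (of_int m / 2) (of_int n / 2) \<tau>"
    using klein_shift[OF assms(1), of "of_int m / 2" i "of_int n / 2" j]
    by (simp add: ij E_def add_divide_distrib)
  moreover have "e2pi E ^ 4 = 1"
  proof -
    have "of_nat 4 * E = of_int (2 * i * j + 2 * i + 2 * j + m * j - n * i)"
      by (simp add: E_def field_simps)
    then show ?thesis
      unfolding e2pi_power by (simp only: e2pi_of_int)
  qed
  ultimately show ?thesis
    by (simp add: klein_half4_def power_mult_distrib)
qed

lemma klein_half4_modular:
  fixes a b c d :: int
  assumes "Im \<tau> > 0" "a * d - b * c = 1"
  defines "J \<equiv> of_int c * \<tau> + of_int d"
  shows "J ^ 4 * klein_half4 m n ((of_int a * \<tau> + of_int b) / J) =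
           klein_half4 (m * a + n * c) (m * b + n * d) \<tau>"
proof -
  have "(J * klein (of_int m / 2) (of_int n / 2) ((of_int a * \<tau> + of_int b) / J)) ^ 4 =
      klein_half4 (m * a + n * c) (m * b + n * d) \<tau>"
    unfolding J_def klein_half4_def klein_modular[OF assms(1,2)]
    by (simp add: add_divide_distrib)
  then show ?thesis
    by (simp add: klein_half4_def power_mult_distrib)
qed

text \<open>A matrix of determinant 1 permutes the three nonzero characteristics modulo 2, and the
  fourth powers depend only on these classes.\<close>

lemma klein_half4_product_modular:
  fixes a b c d :: int
  assumes \<tau>: "Im \<tau> > 0" and det: "a * d - b * c = 1"
  defines "J \<equiv> of_int c * \<tau> + of_int d"
  defines "P \<equiv> \<lambda>t. klein_half4 0 1 t * klein_half4 1 0 t * klein_half4 1 1 t"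
  shows "J ^ 12 * P ((of_int a * \<tau> + of_int b) / J) = P \<tau>"
proof -
  let ?k = "\<lambda>m n. klein_half4 m n \<tau>"
  have "J ^ 12 * P ((of_int a * \<tau> + of_int b) / J) = ?k c d * ?k a b * ?k (a + c) (b + d)"
  proof -
    have J12: "J ^ 12 * (A * B * C) = (J ^ 4 * A) * (J ^ 4 * B) * (J ^ 4 * C)" for A B C :: complex
      by (simp add: power_numeral_reduce)
    show ?thesis
      unfolding P_def J12 unfolding J_def klein_half4_modular[OF \<tau> det] by simp
  qed
  also have "\<dots> = P \<tau>"
  proof -
    have red: "?k m n = ?k (m mod 2) (n mod 2)" for m n
      by (rule klein_half4_cong[OF \<tau>]) (simp_all add: even_diff_iff)
    have sum: "(m + n) mod 2 = (m mod 2 + n mod 2) mod 2" for m n :: int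
      by (simp add: mod_add_eq)
    \<comment> \<open>Only the parities of the entries matter, so a finite check over those with odd
      determinant suffices.\<close>
    have "(a mod 2 * (d mod 2) - b mod 2 * (c mod 2)) mod 2 = (a * d - b * c) mod 2"
      by (intro mod_diff_cong) (simp_all only: mod_mult_eq)
    then have "(a mod 2 * (d mod 2) - b mod 2 * (c mod 2)) mod 2 = 1"
      unfolding det by simp
    moreover have "m mod 2 = 0 \<or> m mod 2 = 1" for m :: int
      by presburger
    note this[of a] this[of b] this[of c] this[of d]
    ultimately show ?thesis
      unfolding red[of c d] red[of a b] red[of "a + c" "b + d"] sum[of a c] sum[of b d] P_def
      by (elim disjE) (simp_all add: mult_ac)
  qed
  finally show ?thesis .
qed

text \<open>The product of the three Klein forms at half-integral characteristics is a constant
  times the power -6 of eta; fourth powers are then taken.\<close>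

lemma klein_half4_product_eq:
  "\<exists>C. C \<noteq> 0 \<and> (\<forall>\<tau>. Im \<tau> > 0 \<longrightarrow>
     klein_half4 0 1 \<tau> * klein_half4 1 0 \<tau> * klein_half4 1 1 \<tau> * dedekind_eta \<tau> ^ 24 = C)"
proof (intro exI conjI allI impI)
  show "(2 * e2pi (- (1 / 4)) * e2pi (- (1 / 8))) ^ 4 \<noteq> 0"
    by simp
  fix \<tau> :: complex assume \<tau>: "Im \<tau> > 0"
  define q where "q = e2pi \<tau>"
  define h where "h = e2pi (\<tau> / 2)"
  define Q where "Q = qpoch q q"
  have q: "norm q < 1" and hq: "h\<^sup>2 = q"
    using norm_e2pi_less_1[OF \<tau>] by (simp_all add: q_def h_def e2pi_power)
  have Q: "Q \<noteq> 0"
    unfolding Q_def by (rule qpoch_q_nonzero[OF q])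
  have half: "e2pi (x - 1 / 2) = - e2pi x" "e2pi (x + 1 / 2) = - e2pi x" for x
    unfolding e2pi_diff e2pi_add by simp_all
  \<comment> \<open>The recurrence at \<open>- 1\<close> yields the factor 2, as
    \<open>1 - (- 1) = 2\<close>.\<close>
  have k01: "klein 0 (1 / 2) \<tau> = 2 * e2pi (- (1 / 4)) * qpoch (- q) q ^ 2 / Q ^ 2"
    using qpoch_rec[OF q, of "- 1"] half(1)[of \<tau>]
    by (simp add: klein_def theta_phi_def q_def [symmetric] Q_def [symmetric] power2_eq_square)
  have k10: "klein (1 / 2) 0 \<tau> = e2pi (- (\<tau> / 8)) * qpoch h q ^ 2 / Q ^ 2"
  proof -
    have "klein (1 / 2) 0 \<tau> = e2pi (\<tau> / 8) * e2pi (- (\<tau> / 4)) * qpoch h q * qpoch (e2pi (\<tau> - \<tau> / 2)) q / Q ^ 2"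
      by (simp add: klein_def theta_phi_def q_def [symmetric] Q_def [symmetric] h_def)
    also have "\<tau> - \<tau> / 2 = \<tau> / 2"
      by simp
    finally show ?thesis
      by (simp add: e2pi_add [symmetric] h_def [symmetric] power2_eq_square)
  qed
  have k11: "klein (1 / 2) (1 / 2) \<tau> = e2pi (- (1 / 8)) * e2pi (- (\<tau> / 8)) * qpoch (- h) q ^ 2 / Q ^ 2"
  proof -
    have "klein (1 / 2) (1 / 2) \<tau> = e2pi ((\<tau> / 2 + 1 / 2) / 4) * e2pi (- (\<tau> / 2 + 1 / 2) / 2) *
        qpoch (e2pi (\<tau> / 2 + 1 / 2)) q * qpoch (e2pi (\<tau> - (\<tau> / 2 + 1 / 2))) q / Q ^ 2"
      by (simp add: klein_def theta_phi_def q_def [symmetric] Q_def [symmetric])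
    also have "\<tau> - (\<tau> / 2 + 1 / 2) = \<tau> / 2 - 1 / 2"
      by simp
    also have "e2pi ((\<tau> / 2 + 1 / 2) / 4) * e2pi (- (\<tau> / 2 + 1 / 2) / 2) = e2pi (- (1 / 8)) * e2pi (- (\<tau> / 8))"
      unfolding e2pi_add [symmetric] by (rule arg_cong[of _ _ e2pi]) (simp add: field_simps)
    finally show ?thesis
      by (simp only: half h_def [symmetric]) (simp add: power2_eq_square)
  qed
  \<comment> \<open>As \<open>h\<close> is a square root of \<open>q\<close>, the last two factors
    multiply to \<open>qpoch q (q^2)\<close>, and Euler's identity applies.\<close>
  have euler: "qpoch (- q) q * qpoch h q * qpoch (- h) q = 1"
    using euler_qpoch_identity[OF q] qpoch_square[OF q, of h] by (simp add: hq mult.assoc)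
  have "klein 0 (1 / 2) \<tau> * klein (1 / 2) 0 \<tau> * klein (1 / 2) (1 / 2) \<tau> =
      2 * e2pi (- (1 / 4)) * e2pi (- (1 / 8)) * (e2pi (- (\<tau> / 8)) ^ 2) *
      (qpoch (- q) q * qpoch h q * qpoch (- h) q) ^ 2 / Q ^ 6"
    unfolding k01 k10 k11 by (simp add: power2_eq_square power_numeral_reduce mult_ac)
  also have "\<dots> = 2 * e2pi (- (1 / 4)) * e2pi (- (1 / 8)) * e2pi (- (\<tau> / 4)) / Q ^ 6"
    unfolding euler by (simp add: e2pi_power)
  finally have 1: "klein 0 (1 / 2) \<tau> * klein (1 / 2) 0 \<tau> * klein (1 / 2) (1 / 2) \<tau> * (e2pi (\<tau> / 4) * Q ^ 6) =
      2 * e2pi (- (1 / 4)) * e2pi (- (1 / 8))"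
    using Q by (simp add: e2pi_minus)
  have 2: "dedekind_eta \<tau> ^ 24 = (e2pi (\<tau> / 4) * Q ^ 6) ^ 4"
    by (simp add: dedekind_eta_eq q_def [symmetric] Q_def [symmetric] power_mult_distrib e2pi_power
        power_mult [symmetric])
  show "klein_half4 0 1 \<tau> * klein_half4 1 0 \<tau> * klein_half4 1 1 \<tau> * dedekind_eta \<tau> ^ 24 =
      (2 * e2pi (- (1 / 4)) * e2pi (- (1 / 8))) ^ 4"
    unfolding 2 1 [symmetric] by (simp add: klein_half4_def power_mult_distrib)
qed

text \<open>The product of Klein forms has weight -12 and is a constant divided by the 24th power of
  eta. The 24th power hides the root of unity in the law of eta itself, which does no harm: the
  exponents of the eta ratio will add up to a multiple of 24.\<close>

lemma dedekind_eta_pow_24_modular: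
  fixes a b c d :: int
  assumes \<tau>: "Im \<tau> > 0" and det: "a * d - b * c = 1"
  defines "J \<equiv> of_int c * \<tau> + of_int d"
  shows "dedekind_eta ((of_int a * \<tau> + of_int b) / J) ^ 24 = J ^ 12 * dedekind_eta \<tau> ^ 24"
proof -
  define \<tau>' where "\<tau>' = (of_int a * \<tau> + of_int b) / J"
  define P where "P = (\<lambda>t. klein_half4 0 1 t * klein_half4 1 0 t * klein_half4 1 1 t)"
  obtain C where C: "C \<noteq> 0" "\<And>\<tau>. Im \<tau> > 0 \<Longrightarrow> P \<tau> * dedekind_eta \<tau> ^ 24 = C"
    using klein_half4_product_eq unfolding P_def by blast
  have \<tau>': "Im \<tau>' > 0"
    using Im_moebius_pos[OF \<tau> det] by (simp add: \<tau>'_def J_def)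
  have "P \<tau> = J ^ 12 * P \<tau>'"
    unfolding \<tau>'_def J_def P_def by (rule klein_half4_product_modular[OF \<tau> det, symmetric])
  then have "P \<tau>' * (J ^ 12 * dedekind_eta \<tau> ^ 24) = C"
    using C(2)[OF \<tau>] by (simp add: mult_ac)
  moreover have "P \<tau>' * dedekind_eta \<tau>' ^ 24 = C"
    by (rule C(2)[OF \<tau>'])
  ultimately show ?thesis
    using C(1) unfolding \<tau>'_def [symmetric] by (metis mult_left_cancel mult_zero_left)
qed

section \<open>Gauss's lemma\<close>

text \<open>Gauss's lemma, with the sign of the half-system permutation read off an arbitrary odd
  \<open>p\<close>-periodic function.\<close>

lemma gauss_lemma_odd_periodic:
  fixes \<psi> :: "int \<Rightarrow> 'a :: comm_ring_1" and p :: nat and d h :: int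
  assumes p: "prime p" "int p = 2 * h + 1" "2 < p" and d: "\<not> int p dvd d"
    and odd: "\<And>x. \<psi> (- x) = - \<psi> x" and per: "\<And>x. \<psi> (x + int p) = \<psi> x"
  shows "(\<Prod>i=1..h. \<psi> (i * d)) = of_int (Legendre d p) * (\<Prod>i=1..h. \<psi> i)"
proof -
  define r where "r i = (i * d) mod int p" for i
  \<comment> \<open>For \<open>i\<close> in the half-system, \<open>\<pi> i\<close> is the absolute
    value of the residue of \<open>i * d\<close> that is smallest in absolute value, and
    \<open>s i\<close> below is its sign.\<close>
  define \<pi> where "\<pi> i = (if r i \<le> h then r i else int p - r i)" for i
  define s where "s i = (if r i \<le> h then 1 else - 1 :: int)" for i
  have pp: "prime (int p)"
    using p(1) by simp
  have s_cong: "[i * d = s i * \<pi> i] (mod int p)" for i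
    by (auto simp: s_def \<pi>_def r_def cong_def mod_simps)
  have ndvd: "\<not> int p dvd i" if "i \<noteq> 0" "\<bar>i\<bar> < int p" for i
    using that zdvd_imp_le[of "int p" "\<bar>i\<bar>"] by auto
  have r_pos: "0 < r i" "r i < int p" if "i \<in> {1..h}" for i
  proof -
    have "\<not> int p dvd i"
      using that p(2) by (intro ndvd) auto
    then have "\<not> int p dvd i * d"
      using d pp by (simp add: prime_dvd_mult_iff)
    then have "r i \<noteq> 0"
      by (simp add: r_def dvd_eq_mod_eq_0)
    moreover have "r i \<ge> 0" "r i < int p"
      using p(3) by (simp_all add: r_def)
    ultimately show "0 < r i" "r i < int p"
      by auto
  qed
  have \<pi>_in: "\<pi> i \<in> {1..h}" if "i \<in> {1..h}" for i
    using r_pos[OF that] p(2) by (auto simp: \<pi>_def)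
  have inj: "inj_on \<pi> {1..h}"
  proof
    fix i j assume ij: "i \<in> {1..h}" "j \<in> {1..h}" "\<pi> i = \<pi> j"
    have "s i = s j \<or> s i = - s j"
      by (auto simp: s_def)
    then have "[i * d = j * d] (mod int p) \<or> [i * d = - (j * d)] (mod int p)"
    proof
      assume "s i = s j"
      then show ?thesis
        using s_cong[of i] s_cong[of j] ij(3) by (auto simp: cong_def)
    next
      assume *: "s i = - s j"
      have "[- (j * d) = - (s j * \<pi> j)] (mod int p)"
        using s_cong[of j] by (simp add: cong_minus_minus_iff)
      then show ?thesis
        using s_cong[of i] ij(3) * by (auto simp: cong_def)
    qed
    then have "int p dvd (i - j) * d \<or> int p dvd (i + j) * d"
      by (auto simp: cong_iff_dvd_diff algebra_simps)
    then have "int p dvd i - j \<or> int p dvd i + j"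
      using d pp by (auto simp: prime_dvd_mult_iff)
    moreover have "\<not> int p dvd i + j"
      using ij p(2) by (intro ndvd) auto
    ultimately have "int p dvd i - j"
      by blast
    moreover have "\<bar>i - j\<bar> < int p"
      using ij(1,2) p(2) by auto
    ultimately show "i = j"
      using ndvd[of "i - j"] by auto
  qed
  have im: "\<pi> ` {1..h} = {1..h}"
    using inj \<pi>_in by (intro endo_inj_surj) auto
  have reindex: "(\<Prod>i=1..h. f (\<pi> i)) = prod f {1..h}" for f :: "int \<Rightarrow> 'b :: comm_monoid_mult"
    using prod.reindex[OF inj, of f] im by simp

  have per_nat: "\<psi> (x + int n * int p) = \<psi> x" for x n
  proof (induction n)
    case (Suc n)
    have "x + int (Suc n) * int p = (x + int n * int p) + int p"
      by (simp add: algebra_simps)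
    then show ?case
      using Suc by (simp only: per)
  qed simp
  have per_int: "\<psi> (x + m * int p) = \<psi> x" for x m
  proof -
    obtain n where "m = int n \<or> m = - int n"
      by (metis int_cases2)
    then show ?thesis
      using per_nat[of x n] per_nat[of "x - int n * int p" n] by auto
  qed
  have per_cong: "\<psi> x = \<psi> y" if "[x = y] (mod int p)" for x y
  proof -
    obtain m where "y = x + int p * m"
      using \<open>[x = y] (mod int p)\<close> by (auto simp: cong_iff_lin)
    then show ?thesis
      using per_int[of x m] by (simp add: mult.commute)
  qed
  have "\<psi> (i * d) = of_int (s i) * \<psi> (\<pi> i)" for i
  proof -
    have "\<psi> (i * d) = \<psi> (s i * \<pi> i)"
      by (intro per_cong s_cong)
    then show ?thesis
      by (simp add: s_def odd)
  qed
  then have 1: "(\<Prod>i=1..h. \<psi> (i * d)) = of_int (\<Prod>i=1..h. s i) * (\<Prod>i=1..h. \<psi> i)"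
    by (simp add: prod.distrib reindex)

  \<comment> \<open>Multiplying the congruences for \<open>i * d\<close> and cancelling
    \<open>Q\<close>, the factorial of \<open>h\<close>, gives the power of \<open>d\<close> in
    Euler's criterion.\<close>
  define Q where "Q = (\<Prod>i=1..h. i)"
  have "[(\<Prod>i=1..h. i * d) = (\<Prod>i=1..h. s i * \<pi> i)] (mod int p)"
    by (intro cong_prod s_cong)
  then have "[d ^ nat h * Q = (\<Prod>i=1..h. s i) * Q] (mod int p)"
    using reindex[of "\<lambda>i. i"] by (simp add: prod.distrib Q_def mult.commute)
  moreover have "coprime Q (int p)"
    unfolding Q_def
  proof (rule prod_coprime_left)
    fix i assume "i \<in> {1..h}"
    then have "\<not> int p dvd i"
      using p(2) by (intro ndvd) auto
    then show "coprime i (int p)"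
      using pp prime_imp_coprime coprime_commute by blast
  qed
  ultimately have "[d ^ nat h = (\<Prod>i=1..h. s i)] (mod int p)"
    by (simp add: cong_mult_rcancel)
  moreover have "[Legendre d (int p) = d ^ ((p - 1) div 2)] (mod int p)"
    using p by (intro euler_criterion)
  moreover have "(p - 1) div 2 = nat h"
    using p(2) by linarith
  ultimately have cong: "[Legendre d (int p) = (\<Prod>i=1..h. s i)] (mod int p)"
    using cong_trans by auto
  have "\<bar>\<Prod>i=1..h. s i\<bar> = (\<Prod>i=1..h. \<bar>s i\<bar>)"
    by (rule abs_prod)
  also have "\<dots> = 1"
    by (intro prod.neutral) (auto simp: s_def)
  finally have "(\<Prod>i=1..h. s i) = 1 \<or> (\<Prod>i=1..h. s i) = - 1"
    by linarith
  moreover have "Legendre d (int p) = 1 \<or> Legendre d (int p) = - 1"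
    using d by (auto simp: Legendre_def cong_0_iff)
  moreover have "\<not> int p dvd 2" "\<not> int p dvd - 2"
    using p(3) zdvd_imp_le[of "int p" 2] by auto
  ultimately have "(\<Prod>i=1..h. s i) = Legendre d (int p)"
    using cong by (auto simp: cong_iff_dvd_diff)
  then show ?thesis
    using 1 by simp
qed

section \<open>Eta functions of prime level\<close>

text \<open>The polynomial with value \<open>y ^ p - 1\<close> is monic and has simple roots, the
  \<open>p\<close>-th roots of unity, so it splits accordingly; the substitution
  \<open>y = 1 / x\<close> gives the claim for \<open>x \<noteq> 0\<close>.\<close>

lemma prod_one_minus_roots_unity:
  assumes "p > 0"
  shows "(\<Prod>j<p. 1 - e2pi (of_nat j / of_nat p) * x) = 1 - x ^ p"
proof (cases "x = 0")
  case True
  then show ?thesis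
    using assms by simp
next
  case False
  define P :: "complex poly" where "P = Polynomial.monom 1 p - 1"
  have poly_P: "poly P z = z ^ p - 1" for z
    by (simp add: P_def poly_monom)
  have "Polynomial.degree P = p"
    unfolding P_def diff_conv_add_uminus using assms
    by (subst degree_add_eq_left) (simp_all add: degree_monom_eq)
  then have lc: "lead_coeff P = 1"
    using assms by (simp add: P_def)
  have "rsquarefree P"
    unfolding rsquarefree_roots
  proof (intro allI notI, elim conjE)
    fix z assume z: "poly P z = 0" "poly (pderiv P) z = 0"
    then have "of_nat p * z ^ (p - 1) = 0"
      by (simp add: P_def pderiv_diff pderiv_monom poly_monom)
    then have "z = 0"
      using assms by simp
    then show False
      using z(1) assms by (simp add: poly_P zero_power)
  qed
  from complex_poly_decompose_rsquarefree[OF this]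
  have "P = (\<Prod>z | z ^ p = 1. [:- z, 1:])"
    by (simp add: lc poly_P)
  then have "poly P y = poly (\<Prod>z | z ^ p = 1. [:- z, 1:]) y" for y
    by simp
  then have P: "y ^ p - 1 = (\<Prod>z | z ^ p = 1. y - z)" for y :: complex
    by (simp add: poly_P poly_prod)
  have "e2pi (of_nat j / of_nat p) = cis (2 * pi * real j / real p)" for j
    by (simp add: e2pi_def cis_conv_exp mult_ac)
  then have "bij_betw (\<lambda>j. e2pi (of_nat j / of_nat p)) {..<p} {z. z ^ p = 1}"
    using Complex.bij_betw_roots_unity[OF assms] by simp
  then have "(\<Prod>j<p. 1 / x - e2pi (of_nat j / of_nat p)) = (1 / x) ^ p - 1"
    unfolding P by (rule prod.reindex_bij_betw)
  moreover have "(\<Prod>j<p. 1 - e2pi (of_nat j / of_nat p) * x) = (\<Prod>j<p. x * (1 / x - e2pi (of_nat j / of_nat p)))"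
    using False by (intro prod.cong) (auto simp: field_simps)
  ultimately have "(\<Prod>j<p. 1 - e2pi (of_nat j / of_nat p) * x) = x ^ p * ((1 / x) ^ p - 1)"
    by (simp add: prod.distrib)
  also have "\<dots> = 1 - x ^ p"
    using False by (simp add: field_simps)
  finally show ?thesis .
qed

lemma prod_qpoch_roots_unity:
  assumes q: "norm q < 1" and "p > 0"
  shows "(\<Prod>j<p. qpoch (e2pi (of_nat j / of_nat p) * q) q) = qpoch (q ^ p) (q ^ p)"
proof (rule LIMSEQ_unique)
  show "(\<lambda>n. \<Prod>i\<le>n. \<Prod>j<p. 1 - e2pi (of_nat j / of_nat p) * q * q ^ i) \<longlonglongrightarrow>
      (\<Prod>j<p. qpoch (e2pi (of_nat j / of_nat p) * q) q)"
    by (rule qpoch_prod[OF q]) simp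
  have "norm (q ^ p) < 1"
    using assms by (simp add: norm_power power_less_one_iff)
  from qpoch_LIMSEQ[OF this]
  have "(\<lambda>n. \<Prod>i\<le>n. 1 - q ^ p * (q ^ p) ^ i) \<longlonglongrightarrow> qpoch (q ^ p) (q ^ p)" .
  moreover have "(\<Prod>j<p. 1 - e2pi (of_nat j / of_nat p) * q * q ^ i) = 1 - q ^ p * (q ^ p) ^ i" for i
    using prod_one_minus_roots_unity[OF \<open>p > 0\<close>, of "q * q ^ i"]
    by (simp only: mult.assoc power_mult_distrib power_mult [symmetric] mult.commute[of p])
  ultimately show "(\<lambda>n. \<Prod>i\<le>n. \<Prod>j<p. 1 - e2pi (of_nat j / of_nat p) * q * q ^ i) \<longlonglongrightarrow>
      qpoch (q ^ p) (q ^ p)"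
    by simp
qed

text \<open>Modulo \<open>2 * h + 1\<close> the numbers \<open>2 * i\<close> and
  \<open>- (2 * i)\<close> run through every nonzero class once: the former are the even
  representatives, and the latter become the odd ones after adding the modulus.\<close>

lemma prod_half_system:
  fixes g :: "int \<Rightarrow> 'a :: comm_monoid_mult"
  assumes "\<And>x. g (x + (2 * h + 1)) = g x"
  shows "(\<Prod>i=1..h. g (2 * i) * g (- (2 * i))) = (\<Prod>j=1..2*h. g j)"
proof -
  have "(\<Prod>j=1..2*h. g j) = (\<Prod>j \<in> (\<lambda>i. 2 * i) ` {1..h} \<union> (\<lambda>i. 2 * h + 1 - 2 * i) ` {1..h}. g j)"
  proof (rule prod.cong)
    show "{1..2*h} = (\<lambda>i. 2 * i) ` {1..h} \<union> (\<lambda>i. 2 * h + 1 - 2 * i) ` {1..h}"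
    proof (intro equalityI subsetI)
      fix j assume j: "j \<in> {1..2*h}"
      show "j \<in> (\<lambda>i. 2 * i) ` {1..h} \<union> (\<lambda>i. 2 * h + 1 - 2 * i) ` {1..h}"
      proof (cases "even j")
        case True
        then show ?thesis
          using j by (intro UnI1 image_eqI[of _ _ "j div 2"]) auto
      next
        case False
        then show ?thesis
          using j by (intro UnI2 image_eqI[of _ _ "(2 * h + 1 - j) div 2"]) (auto elim!: oddE)
      qed
    qed auto
  qed simp
  also have "\<dots> = (\<Prod>j \<in> (\<lambda>i. 2 * i) ` {1..h}. g j) * (\<Prod>j \<in> (\<lambda>i. 2 * h + 1 - 2 * i) ` {1..h}. g j)"
    by (rule prod.union_disjoint) (auto, presburger)
  also have "\<dots> = (\<Prod>i=1..h. g (2 * i)) * (\<Prod>i=1..h. g (2 * h + 1 - 2 * i))"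
    by (subst (1 2) prod.reindex) (auto simp: inj_on_def o_def)
  also have "(\<Prod>i=1..h. g (2 * h + 1 - 2 * i)) = (\<Prod>i=1..h. g (- (2 * i)))"
    using assms[of "- (2 * _)"] by (intro prod.cong) (auto simp: algebra_simps)
  finally show ?thesis
    by (simp add: prod.distrib)
qed

text \<open>The even numerators \<open>2 * i\<close> form a half-system modulo \<open>p\<close> on which \<open>theta_phi \<tau> (2 * i / p)\<close>
  has period \<open>p\<close>; as a function of \<open>j\<close>, \<open>theta_phi \<tau> (j / p)\<close> would only be antiperiodic.\<close>

lemma prod_theta_phi_torsion:
  fixes p :: nat and h :: int
  assumes p: "int p = 2 * h + 1" "h \<ge> 0"
  shows "\<exists>C. C \<noteq> 0 \<and> (\<forall>\<tau>. Im \<tau> > 0 \<longrightarrow>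
    (\<Prod>i=1..h. theta_phi \<tau> (2 * of_int i / of_nat p)) * dedekind_eta \<tau> ^ p =
      C * dedekind_eta (of_nat p * \<tau>))"
proof (intro exI conjI allI impI)
  have p0: "p > 0"
    using p by linarith
  \<comment> \<open>The part of the torsion value that does not depend on \<open>\<tau>\<close>. It
    is nonzero because \<open>0 < 2 * i < p\<close>.\<close>
  define c where "c i = (1 - e2pi (2 * of_int i / of_nat p)) * e2pi (- (2 * of_int i / of_nat p) / 2)" for i :: int
  have "c i \<noteq> 0" if "i \<in> {1..h}" for i
  proof
    assume "c i = 0"
    then obtain n where "2 * of_int i / of_nat p = (of_int n :: complex)"
      by (auto simp: c_def e2pi_eq_1_iff)
    then have "of_int (2 * i) = (of_int (n * int p) :: complex)"
      using p0 by (simp add: field_simps)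
    then have "2 * i = n * int p"
      by (simp only: of_int_eq_iff)
    then have "int p dvd 2 * i"
      by simp
    then show False
      using zdvd_imp_le[of "int p" "2 * i"] that p by auto
  qed
  then show "(\<Prod>i=1..h. c i) \<noteq> 0"
    by simp
  fix \<tau> :: complex assume \<tau>: "Im \<tau> > 0"
  define q where "q = e2pi \<tau>"
  define Q where "Q = qpoch q q"
  define g where "g j = qpoch (e2pi (\<tau> + of_int j / of_nat p)) q" for j
  have q: "norm q < 1"
    using norm_e2pi_less_1[OF \<tau>] by (simp add: q_def)
  have Q: "Q \<noteq> 0"
    unfolding Q_def by (rule qpoch_q_nonzero[OF q])
  have per: "g (x + (2 * h + 1)) = g x" for x
  proof -
    have "e2pi (\<tau> + of_int (x + int p) / of_nat p) = e2pi (\<tau> + of_int x / of_nat p)"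
      by (rule e2pi_cong[of _ _ 1]) (use p0 in \<open>simp add: add_divide_distrib\<close>)
    then show ?thesis
      by (simp add: g_def p(1) [symmetric])
  qed
  have theta: "theta_phi \<tau> (2 * of_int i / of_nat p) = c i * (g (2 * i) * g (- (2 * i))) / Q ^ 2" for i
    by (simp add: theta_phi_split[OF \<tau>] c_def g_def Q_def q_def)
  \<comment> \<open>The extra \<open>Q\<close> equals \<open>g 0\<close> and completes the residue
    system modulo \<open>p\<close>, so the product over all \<open>p\<close>-th roots of unity can
    be evaluated.\<close>
  have "(\<Prod>j=1..2*h. g j) * Q = (\<Prod>j=0..2*h. g j)"
  proof -
    have "{0..2*h} = insert 0 {1..2*h}"
      using p(2) by auto
    then show ?thesis
      by (simp add: g_def Q_def q_def mult.commute)
  qed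
  also have "\<dots> = (\<Prod>j<p. qpoch (e2pi (of_nat j / of_nat p) * q) q)"
    by (rule prod.reindex_bij_witness[of _ int nat])
      (use p in \<open>auto simp: g_def e2pi_add q_def mult.commute\<close>)
  also have "\<dots> = qpoch (q ^ p) (q ^ p)"
    by (rule prod_qpoch_roots_unity[OF q p0])
  finally have 1: "(\<Prod>j=1..2*h. g j) * Q = qpoch (q ^ p) (q ^ p)" .
  have "(\<Prod>i=1..h. theta_phi \<tau> (2 * of_int i / of_nat p)) =
      (\<Prod>i=1..h. c i) * (\<Prod>j=1..2*h. g j) / (Q ^ 2) ^ nat h"
    unfolding theta prod_dividef prod.distrib prod_half_system[of g h, OF per, symmetric] by simp
  moreover have "Q ^ p = (Q ^ 2) ^ nat h * Q"
  proof -
    have "p = 2 * nat h + 1"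
      using p by linarith
    then show ?thesis
      by (simp add: power_mult)
  qed
  ultimately have 2: "(\<Prod>i=1..h. theta_phi \<tau> (2 * of_int i / of_nat p)) * Q ^ p =
      (\<Prod>i=1..h. c i) * qpoch (q ^ p) (q ^ p)"
    using Q by (simp add: 1 [symmetric])
  have "dedekind_eta \<tau> ^ p = e2pi (of_nat p * \<tau> / 24) * Q ^ p"
    by (simp add: dedekind_eta_eq power_mult_distrib e2pi_power Q_def q_def)
  moreover have "dedekind_eta (of_nat p * \<tau>) = e2pi (of_nat p * \<tau> / 24) * qpoch (q ^ p) (q ^ p)"
    by (simp add: dedekind_eta_eq e2pi_power q_def)
  ultimately show "(\<Prod>i=1..h. theta_phi \<tau> (2 * of_int i / of_nat p)) * dedekind_eta \<tau> ^ p =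
      (\<Prod>i=1..h. c i) * dedekind_eta (of_nat p * \<tau>)"
    using 2 by (simp add: mult_ac)
qed

text \<open>The torsion product is expressed by eta with the same constant at \<open>\<tau>\<close>
  and at \<open>\<tau>'\<close>. By the Klein form law the matrix multiplies the torsion index by
  \<open>d\<close>, and Gauss's lemma supplies the sign of the resulting permutation.\<close>

lemma dedekind_eta_prime_modular:
  fixes a b c d :: int and p :: nat
  assumes \<tau>: "Im \<tau> > 0" and det: "a * d - b * c = 1"
    and p: "prime p" "2 < p" and c: "int p ^ 2 dvd c"
  defines "J \<equiv> of_int c * \<tau> + of_int d"
  defines "\<tau>' \<equiv> (of_int a * \<tau> + of_int b) / J"
  shows "dedekind_eta (of_nat p * \<tau>') * dedekind_eta \<tau> ^ p * J ^ ((p - 1) div 2) =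
    of_int (Legendre d p) * dedekind_eta (of_nat p * \<tau>) * dedekind_eta \<tau>' ^ p"
proof -
  have "odd p"
    using p by (intro prime_odd_nat) auto
  then obtain h0 where h0: "p = 2 * h0 + 1"
    by (rule oddE)
  define h where "h = int h0"
  have h: "int p = 2 * h + 1" "h \<ge> 0" "nat h = (p - 1) div 2"
    using h0 by (simp_all add: h_def)
  have \<tau>': "Im \<tau>' > 0"
    using Im_moebius_pos[OF \<tau> det] by (simp add: \<tau>'_def J_def)
  obtain c' where c': "c = int p ^ 2 * c'"
    using c by (rule dvdE)
  have d: "\<not> int p dvd d"
  proof
    assume "int p dvd d"
    then have "int p dvd a * d - b * c"
      by (auto simp: c' power2_eq_square)
    then show False
      unfolding det using p by simp
  qed
  obtain C where C: "C \<noteq> 0" "\<And>\<tau>. Im \<tau> > 0 \<Longrightarrow>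
      (\<Prod>i=1..h. theta_phi \<tau> (2 * of_int i / of_nat p)) * dedekind_eta \<tau> ^ p =
      C * dedekind_eta (of_nat p * \<tau>)"
    using prod_theta_phi_torsion[OF h(1,2)] by blast
  define \<psi> where "\<psi> x = theta_phi \<tau> (2 * of_int x / of_nat p)" for x :: int
  have *: "J * theta_phi \<tau>' (2 * of_int i / of_nat p) = \<psi> (i * d)" for i
  proof -
    have "J * theta_phi \<tau>' (2 * of_int i / of_nat p) = J * klein 0 (2 * of_int i / of_nat p) \<tau>'"
      by (simp add: klein_def)
    also have "\<dots> = klein (2 * of_int i / of_nat p * of_int c) (2 * of_int i / of_nat p * of_int d) \<tau>"
      unfolding \<tau>'_def J_def klein_modular[OF \<tau> det] by simp
    also have "2 * of_int i / of_nat p * of_int c = (0 + of_int (2 * i * int p * c') :: complex)"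
      using p by (simp add: c' power2_eq_square)
    also have "2 * of_int i / of_nat p * of_int d = (2 * of_int i / of_nat p * of_int d + of_int 0 :: complex)"
      by simp
    also have "klein (0 + of_int (2 * i * int p * c')) (2 * of_int i / of_nat p * of_int d + of_int 0) \<tau> =
        klein 0 (2 * of_int i / of_nat p * of_int d) \<tau>"
    proof -
      \<comment> \<open>The cross term is \<open>2 * i^2 * c * d / p^2\<close>, an integer because
        \<open>p^2\<close> divides \<open>c\<close>; the even numerators make the other term
        integral.\<close>
      have "(of_int (2 * i * int p * c') * of_int 0 + of_int (2 * i * int p * c') + of_int 0 + 0 * of_int 0 -
          2 * of_int i / of_nat p * of_int d * of_int (2 * i * int p * c')) / 2 =
          (of_int (i * int p * c' - 2 * i * d * i * c') :: complex)"
        using p by (simp add: field_simps)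
      then show ?thesis
        unfolding klein_shift[OF \<tau>] by (simp only: e2pi_of_int mult_1)
    qed
    finally show ?thesis
      by (simp add: klein_def \<psi>_def mult.assoc)
  qed
  have "J ^ nat h * (\<Prod>i=1..h. theta_phi \<tau>' (2 * of_int i / of_nat p)) =
      (\<Prod>i=1..h. J * theta_phi \<tau>' (2 * of_int i / of_nat p))"
    by (simp add: prod.distrib)
  also have "\<dots> = (\<Prod>i=1..h. \<psi> (i * d))"
    by (simp add: *)
  also have "\<dots> = of_int (Legendre d p) * (\<Prod>i=1..h. \<psi> i)"
  proof (rule gauss_lemma_odd_periodic[OF p(1) h(1) p(2) d])
    show "\<psi> (- x) = - \<psi> x" for x
      using theta_phi_minus[OF \<tau>, of "2 * of_int x / of_nat p"] by (simp add: \<psi>_def)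
    show "\<psi> (x + int p) = \<psi> x" for x
    proof -
      have "2 * of_int (x + int p) / of_nat p = 2 * of_int x / of_nat p + (of_int 2 :: complex)"
        using p by (simp add: field_simps)
      then show ?thesis
        using theta_phi_plus_int[OF \<tau>, of "2 * of_int x / of_nat p" 2] by (simp add: \<psi>_def)
    qed
  qed
  finally have 1: "J ^ nat h * (\<Prod>i=1..h. theta_phi \<tau>' (2 * of_int i / of_nat p)) =
      of_int (Legendre d p) * (\<Prod>i=1..h. \<psi> i)" .
  have "C * (dedekind_eta (of_nat p * \<tau>') * dedekind_eta \<tau> ^ p * J ^ nat h) =
      (J ^ nat h * (\<Prod>i=1..h. theta_phi \<tau>' (2 * of_int i / of_nat p))) * dedekind_eta \<tau>' ^ p * dedekind_eta \<tau> ^ p"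
    using C(2)[OF \<tau>'] by (simp add: mult_ac)
  also have "\<dots> = of_int (Legendre d p) * ((\<Prod>i=1..h. \<psi> i) * dedekind_eta \<tau> ^ p) * dedekind_eta \<tau>' ^ p"
    unfolding 1 by (simp add: mult_ac)
  also have "(\<Prod>i=1..h. \<psi> i) * dedekind_eta \<tau> ^ p = C * dedekind_eta (of_nat p * \<tau>)"
    unfolding \<psi>_def by (rule C(2)[OF \<tau>])
  finally have "C * (dedekind_eta (of_nat p * \<tau>') * dedekind_eta \<tau> ^ p * J ^ nat h) =
      C * (of_int (Legendre d p) * dedekind_eta (of_nat p * \<tau>) * dedekind_eta \<tau>' ^ p)"
    by (simp add: mult_ac)
  then show ?thesis
    using C(1) h(3) by simp
qed

section \<open>The Kronecker symbol\<close>

text \<open>Turns congruences between symbol values, as given by Euler's criterion, into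
  equalities.\<close>

lemma eq_of_cong_small:
  fixes x y :: int
  assumes "[x = y] (mod m)" "x \<in> {-1, 0, 1}" "y \<in> {-1, 0, 1}" "2 < m"
  shows "x = y"
proof -
  have "m dvd x - y"
    using assms(1) by (simp add: cong_iff_dvd_diff)
  moreover have "\<bar>x - y\<bar> \<le> 2"
    using assms(2,3) by auto
  ultimately show ?thesis
    using assms(4) zdvd_imp_le[of m "\<bar>x - y\<bar>"] by (cases "x = y") auto
qed

section \<open>Multiplicativity and supplementary laws of the Legendre symbol\<close>

lemma Legendre_range: "Legendre a p \<in> {-1, 0, 1}"
  by (simp add: Legendre_def)

lemma Legendre_mult:
  fixes p :: nat
  assumes "prime p" "2 < p"
  shows "Legendre (a * b) p = Legendre a p * Legendre b p"
proof (rule eq_of_cong_small)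
  note E = euler_criterion[OF assms]
  have "[Legendre a p * Legendre b p = a ^ ((p - 1) div 2) * b ^ ((p - 1) div 2)] (mod int p)"
    by (intro cong_mult E)
  then show "[Legendre (a * b) p = Legendre a p * Legendre b p] (mod int p)"
    using E[of "a * b"] by (auto simp: power_mult_distrib cong_def)
  show "Legendre a p * Legendre b p \<in> {-1, 0, 1}"
    using Legendre_range[of a p] Legendre_range[of b p] by auto
qed (use Legendre_range assms in auto)

lemma Legendre_minus_1:
  fixes p :: nat
  assumes "prime p" "2 < p"
  shows "Legendre (- 1) p = (- 1) ^ ((p - 1) div 2)"
proof (rule eq_of_cong_small)
  show "(- 1 :: int) ^ ((p - 1) div 2) \<in> {-1, 0, 1}"
    by (cases "even ((p - 1) div 2)") auto
  show "[Legendre (- 1) p = (- 1) ^ ((p - 1) div 2)] (mod int p)"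
    by (rule euler_criterion[OF assms])
qed (use Legendre_range assms in auto)

text \<open>Gauss's lemma for the function that is \<open>1\<close> on the lower and
  \<open>- 1\<close> on the upper half of the nonzero residues: the symbol is the parity of the
  number of \<open>i \<le> h\<close> with \<open>2 * i > h\<close>.\<close>

lemma Legendre_2:
  fixes p :: nat
  assumes p: "prime p" "2 < p"
  shows "Legendre 2 p = (if p mod 8 \<in> {1, 7} then 1 else - 1)"
proof -
  have "odd p"
    using p by (intro prime_odd_nat) auto
  then obtain h where h: "p = 2 * h + 1"
    by (rule oddE)
  define \<psi> :: "int \<Rightarrow> int" where
    "\<psi> x = (if x mod int p = 0 then 0 else if x mod int p \<le> int h then 1 else - 1)" for x
  have "(\<Prod>i=1..int h. \<psi> (i * 2)) = of_int (Legendre 2 p) * (\<Prod>i=1..int h. \<psi> i)"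
  proof (rule gauss_lemma_odd_periodic[OF p(1) _ p(2)])
    show "\<not> int p dvd 2"
      using p(2) zdvd_imp_le[of "int p" 2] by auto
    show "\<psi> (- x) = - \<psi> x" for x
    proof (cases "x mod int p = 0")
      case False
      then have "(- x) mod int p = int p - x mod int p"
        by (simp add: zmod_zminus1_eq_if)
      moreover have "0 < x mod int p" "x mod int p < int p"
        using False p(2) pos_mod_sign[of "int p" x] pos_mod_bound[of "int p" x] by linarith+
      ultimately show ?thesis
        using False h by (auto simp: \<psi>_def)
    qed (simp add: \<psi>_def zmod_zminus1_eq_if)
  qed (simp_all add: h \<psi>_def)
  also have "(\<Prod>i=1..int h. \<psi> i) = 1"
    by (intro prod.neutral) (auto simp: \<psi>_def h)
  also have "(\<Prod>i=1..int h. \<psi> (i * 2)) = (\<Prod>i=1..int h. if int h < 2 * i then - 1 else 1)"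
    by (intro prod.cong) (auto simp: \<psi>_def h)
  also have "\<dots> = (- 1) ^ card {i \<in> {1..int h}. int h < 2 * i}"
    by (simp add: prod.If_cases Int_def)
  also have "{i \<in> {1..int h}. int h < 2 * i} = {int h div 2 + 1..int h}"
    by auto
  finally have "Legendre 2 p = (- 1) ^ nat (int h - int h div 2)"
    by (simp add: algebra_simps)
  moreover have "even (nat (int h - int h div 2)) \<longleftrightarrow> p mod 8 \<in> {1, 7}"
  proof -
    \<comment> \<open>With \<open>h = 4 * k + j\<close> one has
      \<open>p = 8 * k + 2 * j + 1\<close>, so both the parity and the residue modulo 8 depend only
      on \<open>j\<close>.\<close>
    define k j where "k = h div 4" "j = h mod 4"
    then have hkj: "h = 4 * k + j" and "j < 4"
      by simp_all
    have "nat (int h - int h div 2) = 2 * k + (j - j div 2)"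
      unfolding hkj by linarith
    moreover have "p mod 8 = (2 * j + 1) mod 8"
    proof -
      have "p = 2 * j + 1 + k * 8"
        by (simp add: h hkj)
      then show ?thesis
        by (simp only: mod_mult_self1)
    qed
    moreover have "j = 0 \<or> j = 1 \<or> j = 2 \<or> j = 3"
      using \<open>j < 4\<close> by linarith
    ultimately show ?thesis
      by (elim disjE) simp_all
  qed
  ultimately show ?thesis
    by auto
qed

section \<open>Multiplicativity and values of the Kronecker symbol\<close>

lemma prime_int_cases:
  assumes "prime (q :: int)"
  obtains p where "q = int p" "prime p"
  using assms prime_int_nat_transfer[of q] prime_ge_0_int[of q]
  by (metis int_nat_eq)

lemma kronecker_prime_range:
  "kronecker_prime a q \<in> {-1, 0, 1}"
  using Legendre_range[of a q] by (auto simp: kronecker_prime_def)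

lemma kronecker_prime_mult:
  assumes "prime q"
  shows "kronecker_prime (a * b) q = kronecker_prime a q * kronecker_prime b q"
proof (cases "q = 2")
  case True
  show ?thesis
  proof (cases "even a \<or> even b")
    case False
    have mod8: "x mod 8 = 1 \<or> x mod 8 = 3 \<or> x mod 8 = 5 \<or> x mod 8 = 7" if "odd x" for x :: int
      using that by presburger
    have kp2: "kronecker_prime x 2 = (if x mod 8 = 1 \<or> x mod 8 = 7 then 1 else - 1)" if "odd x" for x
      using that by (simp add: kronecker_prime_def)
    have odd: "odd a" "odd b" "odd (a * b)"
      using False by auto
    have ab: "(a * b) mod 8 = (a mod 8 * (b mod 8)) mod 8"
      by (simp add: mod_mult_eq)
    show ?thesis
      unfolding True odd[THEN kp2] ab using odd(1,2)[THEN mod8]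
      by (elim disjE) simp_all
  qed (use True in \<open>auto simp: kronecker_prime_def\<close>)
next
  case False
  obtain p where p: "q = int p" "prime p"
    using prime_int_cases[OF assms] .
  then have "2 < p"
    using False prime_ge_2_nat[of p] by auto
  then show ?thesis
    using False p by (simp add: kronecker_prime_def Legendre_mult)
qed

lemma kronecker_prime_unit:
  assumes "prime q" "\<not> q dvd a"
  shows "kronecker_prime a q \<in> {-1, 1}"
  using assms by (auto simp: kronecker_prime_def Legendre_def cong_0_iff)

lemma kronecker_prime_1 [simp]: "prime q \<Longrightarrow> kronecker_prime 1 q = 1"
proof -
  assume q: "prime q"
  have "\<not> q dvd 1"
    using q by auto
  moreover have "QuadRes q 1"
    by (auto simp: QuadRes_def intro: exI[of _ 1])
  ultimately show ?thesis
    by (auto simp: kronecker_prime_def Legendre_def cong_0_iff)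
qed

text \<open>For \<open>n \<noteq> 0\<close> this is the symbol at the absolute value of
  \<open>n\<close>. Over the multiset of prime factors, multiplicativity in either argument reduces
  to properties of multiset products.\<close>

definition kronecker_abs :: "int \<Rightarrow> int \<Rightarrow> int" where
  "kronecker_abs a n = prod_mset (image_mset (kronecker_prime a) (prime_factorization n))"

lemma kronecker_altdef:
  assumes "n \<noteq> 0"
  shows "kronecker a n = (if n < 0 \<and> a < 0 then - 1 else 1) * kronecker_abs a n"
proof -
  have "(\<Prod>p\<in>prime_factors n. kronecker_prime a p ^ multiplicity p n) =
      (\<Prod>p\<in>prime_factors n. kronecker_prime a p ^ count (prime_factorization n) p)"
    by (intro prod.cong) (auto simp: count_prime_factorization)
  then show ?thesis
    using assms by (simp add: kronecker_def kronecker_abs_def image_prod_mset_multiplicity)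
qed

lemma kronecker_abs_mult_left: "kronecker_abs (a * b) n = kronecker_abs a n * kronecker_abs b n"
proof -
  have "image_mset (kronecker_prime (a * b)) (prime_factorization n) =
      image_mset (\<lambda>q. kronecker_prime a q * kronecker_prime b q) (prime_factorization n)"
    by (intro image_mset_cong) (auto simp: kronecker_prime_mult in_prime_factors_iff)
  then show ?thesis
    by (simp add: kronecker_abs_def prod_mset.distrib)
qed

text \<open>Zero factors are excluded because of the sign convention: for \<open>n = - 1\<close>,
  \<open>a = 0\<close> and \<open>b < 0\<close> the left side would be \<open>1\<close> and the
  right side \<open>- 1\<close>.\<close>

lemma kronecker_mult_left:
  assumes "n \<noteq> 0" "a \<noteq> 0" "b \<noteq> 0"
  shows "kronecker (a * b) n = kronecker a n * kronecker b n"
  using assms by (auto simp: kronecker_altdef kronecker_abs_mult_left mult_less_0_iff)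

lemma kronecker_mult_right:
  assumes "m > 0" "n > 0"
  shows "kronecker a (m * n) = kronecker a m * kronecker a n"
  using assms
  by (simp add: kronecker_altdef kronecker_abs_def prime_factorization_mult mult_less_0_iff)

lemma kronecker_1_right [simp]: "kronecker a 1 = 1"
  by (simp add: kronecker_altdef kronecker_abs_def)

lemma kronecker_abs_1 [simp]: "kronecker_abs 1 n = 1"
proof -
  have "image_mset (kronecker_prime 1) (prime_factorization n) = image_mset (\<lambda>_. 1) (prime_factorization n)"
    by (intro image_mset_cong) (auto simp: in_prime_factors_iff)
  then show ?thesis
    by (simp add: kronecker_abs_def)
qed

lemma kronecker_1_left [simp]: "kronecker 1 n = 1"
  by (cases "n = 0") (simp_all add: kronecker_altdef, simp add: kronecker_def)

lemma kronecker_prime_right: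
  assumes "prime q"
  shows "kronecker a q = kronecker_prime a q"
  using assms prime_gt_0_int[OF assms]
  by (simp add: kronecker_altdef kronecker_abs_def prime_factorization_prime)

lemma kronecker_range: "kronecker a n \<in> {-1, 0, 1}"
proof (cases "n = 0")
  case False
  have "prod_mset (image_mset (kronecker_prime a) A) \<in> {-1, 0, 1}" for A
  proof (induction A)
    case (add q A)
    then show ?case
      using kronecker_prime_range[of a q] by auto
  qed simp
  then show ?thesis
    using False by (auto simp: kronecker_altdef kronecker_abs_def)
qed (simp add: kronecker_def)

lemma kronecker_unit:
  assumes "n \<noteq> 0" "coprime a n"
  shows "kronecker a n \<in> {-1, 1}"
proof -
  have "prod_mset (image_mset (kronecker_prime a) A) \<in> {-1, 1}"
    if "\<And>q. q \<in># A \<Longrightarrow> prime q \<and> \<not> q dvd a" for A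
    using that
  proof (induction A)
    case (add q A)
    have "kronecker_prime a q \<in> {-1, 1}"
      using add.prems[of q] by (intro kronecker_prime_unit) auto
    moreover have "prod_mset (image_mset (kronecker_prime a) A) \<in> {-1, 1}"
      using add by auto
    ultimately show ?case
      by auto
  qed simp
  moreover have "prime q \<and> \<not> q dvd a" if "q \<in># prime_factorization n" for q
  proof -
    have "prime q" "q dvd n"
      using that by (auto simp: in_prime_factors_iff)
    then show ?thesis
      using assms(2) by (meson coprime_common_divisor not_prime_unit)
  qed
  ultimately show ?thesis
    using assms(1) by (auto simp: kronecker_altdef kronecker_abs_def)
qed

section \<open>Quadratic reciprocity for the Kronecker symbol\<close>

lemma kronecker_prime_reciprocity:
  fixes p :: nat and q :: int
  assumes p: "prime p" "2 < p" and q: "prime q" "q \<noteq> int p"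
  shows "Legendre q p = kronecker_prime p q * kronecker_prime (- 1) q ^ ((p - 1) div 2)"
\<comment> \<open>The power of \<open>kronecker_prime (- 1) q\<close> makes the formula uniform: it
  is \<open>1\<close> for \<open>q = 2\<close>, since -1 is 7 modulo 8, and the usual reciprocity
  sign for odd \<open>q\<close>.\<close>
proof (cases "q = 2")
  case True
  have "odd p"
    using p by (intro prime_odd_nat) auto
  moreover have "int p mod 8 \<in> {1, 7} \<longleftrightarrow> p mod 8 \<in> {1, 7}"
    using of_nat_mod[of p 8, where 'a = int] by auto
  ultimately show ?thesis
    using True by (simp add: kronecker_prime_def Legendre_2[OF p])
next
  case False
  obtain l where l: "q = int l" "prime l"
    using prime_int_cases[OF q(1)] .
  then have "2 < l"
    using False prime_ge_2_nat[of l] by auto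
  have QR: "Legendre l p * Legendre p l = (- 1) ^ ((l - 1) div 2 * ((p - 1) div 2))"
    using p l \<open>2 < l\<close> q(2) by (intro Quadratic_Reciprocity) auto
  have "Legendre p l * Legendre p l = 1"
  proof -
    have "\<not> int l dvd int p"
      using p l q(2) primes_dvd_imp_eq[of l p] by auto
    then have "Legendre p l \<in> {-1, 1}"
      using kronecker_prime_unit[of "int l" "int p"] l False by (simp add: kronecker_prime_def)
    then show ?thesis
      by auto
  qed
  then have "Legendre l p = Legendre l p * Legendre p l * Legendre p l"
    by (simp add: mult.assoc)
  then show ?thesis
    unfolding QR using False l
    by (simp add: kronecker_prime_def Legendre_minus_1[OF l(2) \<open>2 < l\<close>] power_mult mult.commute)
qed

text \<open>For odd \<open>m\<close> and \<open>n\<close> the exponents on both sides agree modulo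
  2. This carries reciprocity signs through an induction over prime factors.\<close>

lemma minus_one_power_half_mult:
  fixes x :: int and m n :: nat
  assumes "x \<in> {-1, 1}" "odd m" "odd n"
  shows "x ^ ((m * n - 1) div 2) = x ^ ((m - 1) div 2) * x ^ ((n - 1) div 2)"
proof -
  obtain i j where "m = 2 * i + 1" "n = 2 * j + 1"
    using assms(2,3) by (auto elim!: oddE)
  then have "(m * n - 1) div 2 = 2 * (i * j) + i + j" "(m - 1) div 2 = i" "(n - 1) div 2 = j"
    by (simp_all add: algebra_simps)
  moreover have "x ^ (2 * (i * j)) = 1"
    using assms(1) by (auto simp: power_mult)
  ultimately show ?thesis
    by (simp add: power_add)
qed

lemma kronecker_reciprocity_prime_left:
  fixes n :: nat and q :: int
  assumes "odd n" "prime q" "\<not> q dvd int n"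
  shows "kronecker q n = kronecker_prime n q * kronecker_prime (- 1) q ^ ((n - 1) div 2)"
  using assms(1,3)
proof (induction n rule: prime_divisors_induct)
  case (factor p n)
  have p: "prime p" "odd p" "odd n" "p > 2"
    using factor by (auto simp: prime_gt_0_nat dest: prime_ge_2_nat intro: ccontr)
      (metis even_mult_iff le_neq_implies_less prime_ge_2_nat even_numeral)
  have n: "n > 0"
    using p(3) by (rule odd_pos)
  have q: "\<not> q dvd int n" "q \<noteq> int p"
    using factor by auto
  have unit: "kronecker_prime (- 1) q \<in> {-1, 1}"
    using assms(2) not_prime_unit by (intro kronecker_prime_unit) auto
  have "kronecker q (int (p * n)) = kronecker q (int p) * kronecker q (int n)"
    using kronecker_mult_right[of "int p" "int n" q] n p(1) by (simp add: prime_gt_0_nat)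
  also have "kronecker q (int p) = Legendre q p"
    using p by (simp add: kronecker_prime_right kronecker_prime_def)
  also have "\<dots> = kronecker_prime p q * kronecker_prime (- 1) q ^ ((p - 1) div 2)"
    using p assms(2) q by (intro kronecker_prime_reciprocity) auto
  also have "kronecker q (int n) = kronecker_prime n q * kronecker_prime (- 1) q ^ ((n - 1) div 2)"
    using p(3) q(1) by (rule factor.IH)
  also have "kronecker_prime p q * kronecker_prime (- 1) q ^ ((p - 1) div 2) *
      (kronecker_prime n q * kronecker_prime (- 1) q ^ ((n - 1) div 2)) =
      kronecker_prime (p * n) q * kronecker_prime (- 1) q ^ ((p * n - 1) div 2)"
    unfolding minus_one_power_half_mult[OF unit p(2,3)] of_nat_mult
    by (simp add: kronecker_prime_mult[OF assms(2)] mult_ac)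
  finally show ?case .
qed (use assms(2) in auto)

lemma kronecker_minus_1_left:
  fixes n :: nat
  assumes "odd n"
  shows "kronecker (- 1) n = (- 1) ^ ((n - 1) div 2)"
  using assms
proof (induction n rule: prime_divisors_induct)
  case (factor p n)
  have p: "prime p" "odd p" "odd n" "p > 2"
    using factor by (auto simp: prime_gt_0_nat dest: prime_ge_2_nat intro: ccontr)
      (metis even_mult_iff le_neq_implies_less prime_ge_2_nat even_numeral)
  have "kronecker (- 1) (int (p * n)) = kronecker (- 1) (int p) * kronecker (- 1) (int n)"
    using kronecker_mult_right[of "int p" "int n"] odd_pos[OF p(3)] p(1) by (simp add: prime_gt_0_nat)
  also have "kronecker (- 1) (int p) = (- 1) ^ ((p - 1) div 2)"
    using p by (simp add: kronecker_prime_right kronecker_prime_def Legendre_minus_1)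
  also have "kronecker (- 1) (int n) = (- 1) ^ ((n - 1) div 2)"
    using p(3) by (rule factor.IH)
  finally show ?case
    using minus_one_power_half_mult[of "- 1" p n] p by simp
qed auto

text \<open>The cases of prime upper argument are multiplied over the prime factors of
  \<open>d\<close>, which may be even or negative.\<close>

lemma kronecker_reciprocity:
  fixes n :: nat and d :: int
  assumes n: "odd n" and d: "d \<noteq> 0" "coprime d (int n)"
  shows "kronecker d n = kronecker n d * kronecker (- 1) d ^ ((n - 1) div 2)"
proof -
  let ?e = "(n - 1) div 2"
  have n0: "n > 0"
    using n by (rule odd_pos)
  have mset: "kronecker (prod_mset A) n = prod_mset (image_mset (\<lambda>q. kronecker q n) A)"
    if "\<forall>q\<in>#A. prime q" for A :: "int multiset"
    using that
  proof (induction A)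
    case (add q A)
    have "prod_mset A \<noteq> 0" "q \<noteq> 0"
      using add.prems by auto
    then show ?case
      using add n0 by (simp add: kronecker_mult_left)
  qed simp
  have "d = sgn d * \<bar>d\<bar>"
    by (simp add: sgn_mult_abs)
  also have "\<bar>d\<bar> = prod_mset (prime_factorization d)"
    using d(1) by (simp add: prod_mset_prime_factorization)
  finally have "kronecker d n = kronecker (sgn d) n * kronecker (prod_mset (prime_factorization d)) n"
    using kronecker_mult_left[of "int n" "sgn d" "prod_mset (prime_factorization d)"] d(1) n0
    by (simp add: sgn_0_0)
  also have "kronecker (prod_mset (prime_factorization d)) n =
      prod_mset (image_mset (\<lambda>q. kronecker q n) (prime_factorization d))"
    by (rule mset) (auto simp: in_prime_factors_iff)
  also have "image_mset (\<lambda>q. kronecker q n) (prime_factorization d) =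
      image_mset (\<lambda>q. kronecker_prime n q * kronecker_prime (- 1) q ^ ?e) (prime_factorization d)"
  proof (rule image_mset_cong)
    fix q assume "q \<in># prime_factorization d"
    then have q: "prime q" "q dvd d"
      by (auto simp: in_prime_factors_iff)
    then have "\<not> q dvd int n"
      using d(2) by (meson coprime_common_divisor not_prime_unit)
    then show "kronecker q n = kronecker_prime n q * kronecker_prime (- 1) q ^ ?e"
      using kronecker_reciprocity_prime_left[OF n q(1)] by blast
  qed
  also have "prod_mset \<dots> = kronecker_abs n d * kronecker_abs (- 1) d ^ ?e"
  proof -
    have pow: "prod_mset (image_mset (\<lambda>q. f q ^ k) A) = prod_mset (image_mset f A) ^ k" for f :: "int \<Rightarrow> int" and k A
      by (induction A) (auto simp: power_mult_distrib)
    show ?thesis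
      by (simp add: prod_mset.distrib kronecker_abs_def pow)
  qed
  \<comment> \<open>The sign of \<open>d\<close> contributes exactly the sign factor built into
    \<open>kronecker (- 1) d\<close>, raised to the same power.\<close>
  also have "kronecker (sgn d) n = (if d < 0 then - 1 else 1) ^ ?e"
    using d(1) kronecker_minus_1_left[OF n] by (auto simp: sgn_if)
  finally show ?thesis
    using d(1) n0 by (simp add: kronecker_altdef power_mult_distrib)
qed

section \<open>Rational upper arguments\<close>

lemma kronecker_sq:
  assumes "d \<noteq> 0" "coprime a d"
  shows "kronecker a d * kronecker a d = 1"
  using kronecker_unit[OF assms] by auto

text \<open>Passing to the reduced fraction keeps the value: cross-multiplication compares the
  symbols, and each symbol prime to \<open>d\<close> is its own inverse.\<close>

lemma kronecker_rat_divide: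
  fixes A B d :: int
  assumes d: "d \<noteq> 0" and AB: "A \<noteq> 0" "B \<noteq> 0" "coprime A d" "coprime B d"
  shows "kronecker_rat (of_int A / of_int B) d = kronecker A d * kronecker B d"
proof -
  obtain n m where nm: "quotient_of (of_int A / of_int B) = (n, m)"
    by (cases "quotient_of (of_int A / of_int B)")
  have m: "m > 0" and cop: "coprime n m"
    using quotient_of_denom_pos[OF nm] quotient_of_coprime[OF nm] by auto
  have "(of_int A / of_int B :: rat) = of_int n / of_int m"
    by (rule quotient_of_div[OF nm])
  then have "(of_int (A * m) :: rat) = of_int (n * B)"
    using AB m by (simp add: field_simps)
  then have eq: "A * m = n * B"
    by (simp only: of_int_eq_iff)
  \<comment> \<open>The reduced denominator divides \<open>B\<close>, hence is prime to
    \<open>d\<close>, so its symbol squares to \<open>1\<close>.\<close>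
  have "m dvd n * B"
    using eq by (metis dvd_triv_right)
  then have "m dvd B"
    using cop by (simp add: coprime_commute coprime_dvd_mult_right_iff)
  then have "coprime m d"
    using AB(4) by (meson coprime_divisors dvd_refl)
  have "n \<noteq> 0"
    using eq AB m by auto
  have "kronecker A d * kronecker m d = kronecker n d * kronecker B d"
    using kronecker_mult_left[of d A m] kronecker_mult_left[of d n B] eq d AB m \<open>n \<noteq> 0\<close> by simp
  then have "kronecker A d * kronecker m d * (kronecker m d * kronecker B d) =
      kronecker n d * kronecker B d * (kronecker m d * kronecker B d)"
    by simp
  then have "kronecker A d * kronecker B d * (kronecker m d * kronecker m d) =
      kronecker n d * kronecker m d * (kronecker B d * kronecker B d)"
    by (simp add: mult_ac)
  then show ?thesis
    using nm by (simp add: kronecker_rat_def kronecker_sq[OF d] \<open>coprime m d\<close> AB(4))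
qed

text \<open>A relation, so that any fraction prime to \<open>d\<close>, reduced or not, can witness
  a value; products and powers then never require reduction to lowest terms.\<close>

definition kronecker_frac :: "int \<Rightarrow> rat \<Rightarrow> int \<Rightarrow> bool" where
  "kronecker_frac d x v \<longleftrightarrow> (\<exists>A B. A \<noteq> 0 \<and> B \<noteq> 0 \<and> coprime A d \<and> coprime B d \<and>
     x = of_int A / of_int B \<and> v = kronecker A d * kronecker B d)"

context
  fixes d :: int
  assumes d: "d \<noteq> 0"
begin

lemma kronecker_frac_imp_eq: "kronecker_frac d x v \<Longrightarrow> kronecker_rat x d = v"
  using kronecker_rat_divide[OF d] by (auto simp: kronecker_frac_def)

lemma kronecker_frac_of_int:
  assumes "a \<noteq> 0" "coprime a d"
  shows "kronecker_frac d (of_int a) (kronecker a d)"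
  unfolding kronecker_frac_def using assms by (intro exI[of _ a] exI[of _ 1]) simp

lemma kronecker_frac_mult:
  assumes "kronecker_frac d x v" "kronecker_frac d y w"
  shows "kronecker_frac d (x * y) (v * w)"
proof -
  obtain A B where 1: "A \<noteq> 0" "B \<noteq> 0" "coprime A d" "coprime B d" "x = of_int A / of_int B"
      "v = kronecker A d * kronecker B d"
    using assms(1) by (auto simp: kronecker_frac_def)
  obtain A' B' where 2: "A' \<noteq> 0" "B' \<noteq> 0" "coprime A' d" "coprime B' d" "y = of_int A' / of_int B'"
      "w = kronecker A' d * kronecker B' d"
    using assms(2) by (auto simp: kronecker_frac_def)
  show ?thesis
    unfolding kronecker_frac_def using 1 2 d
    by (intro exI[of _ "A * A'"] exI[of _ "B * B'"]) (simp add: kronecker_mult_left mult_ac)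
qed

lemma kronecker_frac_inverse:
  assumes "kronecker_frac d x v"
  shows "kronecker_frac d (inverse x) v"
  using assms unfolding kronecker_frac_def by (metis inverse_divide mult.commute)

lemma kronecker_frac_power:
  assumes "kronecker_frac d x v"
  shows "kronecker_frac d (x ^ n) (v ^ n)"
proof (induction n)
  case 0
  show ?case
    using kronecker_frac_of_int[of 1] by simp
next
  case (Suc n)
  then show ?case
    using kronecker_frac_mult[OF assms] by simp
qed

text \<open>Inverting the fraction leaves the symbol unchanged, so the absolute value of the
  exponent suffices.\<close>

lemma kronecker_frac_power_int:
  assumes "kronecker_frac d x v"
  shows "kronecker_frac d (x powi n) (v ^ nat \<bar>n\<bar>)"
  using kronecker_frac_power[OF assms, of "nat n"]
    kronecker_frac_power[OF kronecker_frac_inverse[OF assms], of "nat (- n)"]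
  by (auto simp: power_int_def)

lemma kronecker_frac_prod:
  assumes "\<And>i. i \<in> I \<Longrightarrow> kronecker_frac d (f i) (g i)"
  shows "kronecker_frac d (prod f I) (prod g I)"
  using assms
proof (induction I rule: infinite_finite_induct)
  case (insert i I)
  then show ?case
    by (simp add: kronecker_frac_mult)
qed (use kronecker_frac_of_int[of 1] in simp_all)

end

text \<open>Reciprocity flips every symbol at the cost of a power of
  \<open>kronecker (- 1) d\<close>; the parity hypothesis identifies the total power with the
  \<open>k\<close>-th, which becomes the factor \<open>(-1) powi k\<close> of the upper
  argument.\<close>

lemma prod_kronecker_eq_kronecker_rat:
  fixes N :: nat and r :: "nat \<Rightarrow> int" and k d :: int
  assumes N: "odd N" and d: "coprime d (int N)"
    and k: "even ((\<Sum>\<delta> | \<delta> dvd N. r \<delta> * int ((\<delta> - 1) div 2)) - k)"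
  shows "(\<Prod>\<delta> | \<delta> dvd N. kronecker d \<delta> ^ nat \<bar>r \<delta>\<bar>) =
    kronecker_rat ((-1) powi k * (\<Prod>\<delta> | \<delta> dvd N. of_nat \<delta> powi r \<delta>)) d"
\<comment> \<open>For \<open>d = 0\<close> coprimality forces \<open>N = 1\<close> and the parity
  hypothesis makes \<open>k\<close> even, so both sides are \<open>1\<close>.\<close>
proof (cases "d = 0")
  case True
  then have "N = 1"
    using d by simp
  then have "{\<delta>. \<delta> dvd N} = {1}"
    by auto
  moreover have "even k"
    using k unfolding calculation by simp
  ultimately show ?thesis
    using True by (simp add: power_int_minus_left kronecker_rat_def)
next
  case False
  define D where "D = {\<delta>. \<delta> dvd N}"
  define e where "e \<delta> = (\<delta> - 1) div 2" for \<delta> :: nat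
  define \<kappa> where "\<kappa> = kronecker (- 1) d"
  have \<kappa>: "\<kappa> \<in> {-1, 1}"
    unfolding \<kappa>_def by (rule kronecker_unit[OF False]) simp
  have \<delta>: "odd \<delta>" "coprime d (int \<delta>)" "\<delta> \<noteq> 0" if "\<delta> \<in> D" for \<delta>
  proof -
    show "odd \<delta>"
      using that N dvd_trans[of 2 \<delta> N] by (auto simp: D_def)
    then show "\<delta> \<noteq> 0"
      using odd_pos by blast
    show "coprime d (int \<delta>)"
      using that d coprime_divisors[of d d "int \<delta>" "int N"] by (simp add: D_def)
  qed
  have "(\<Prod>\<delta>\<in>D. kronecker d \<delta> ^ nat \<bar>r \<delta>\<bar>) =
      (\<Prod>\<delta>\<in>D. kronecker \<delta> d ^ nat \<bar>r \<delta>\<bar> * \<kappa> ^ (e \<delta> * nat \<bar>r \<delta>\<bar>))"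
    using \<delta> False by (intro prod.cong)
      (auto simp: kronecker_reciprocity \<kappa>_def e_def power_mult_distrib power_mult)
  also have "\<dots> = (\<Prod>\<delta>\<in>D. kronecker \<delta> d ^ nat \<bar>r \<delta>\<bar>) * \<kappa> ^ (\<Sum>\<delta>\<in>D. e \<delta> * nat \<bar>r \<delta>\<bar>)"
    by (simp add: prod.distrib power_sum)
  also have "\<kappa> ^ (\<Sum>\<delta>\<in>D. e \<delta> * nat \<bar>r \<delta>\<bar>) = \<kappa> ^ nat \<bar>k\<bar>"
  proof -
    have "even (\<Sum>\<delta>\<in>D. int (e \<delta> * nat \<bar>r \<delta>\<bar>) - r \<delta> * int (e \<delta>))"
      by (rule dvd_sum) (auto simp: abs_if)
    then have "even (int (\<Sum>\<delta>\<in>D. e \<delta> * nat \<bar>r \<delta>\<bar>) - (\<Sum>\<delta>\<in>D. r \<delta> * int (e \<delta>)))"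
      by (simp add: sum_subtractf)
    moreover have "even ((\<Sum>\<delta>\<in>D. r \<delta> * int (e \<delta>)) - k)"
      using k unfolding D_def e_def .
    ultimately have "even (\<Sum>\<delta>\<in>D. e \<delta> * nat \<bar>r \<delta>\<bar>) \<longleftrightarrow> even (nat \<bar>k\<bar>)"
      by (simp add: even_nat_iff del: of_nat_sum)
    then show ?thesis
      using \<kappa> by auto
  qed
  also have "(\<Prod>\<delta>\<in>D. kronecker \<delta> d ^ nat \<bar>r \<delta>\<bar>) * \<kappa> ^ nat \<bar>k\<bar> =
      kronecker_rat ((-1) powi k * (\<Prod>\<delta>\<in>D. of_nat \<delta> powi r \<delta>)) d"
  proof -
    have "kronecker_frac d ((-1) powi k) (\<kappa> ^ nat \<bar>k\<bar>)"
      unfolding \<kappa>_def using kronecker_frac_of_int[OF False, of "- 1"]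
      by (intro kronecker_frac_power_int[OF False]) simp
    moreover have "kronecker_frac d (\<Prod>\<delta>\<in>D. of_nat \<delta> powi r \<delta>) (\<Prod>\<delta>\<in>D. kronecker \<delta> d ^ nat \<bar>r \<delta>\<bar>)"
      using kronecker_frac_of_int[OF False, of "int _"] \<delta>
      by (intro kronecker_frac_prod[OF False] kronecker_frac_power_int[OF False])
         (simp add: coprime_commute)
    ultimately show ?thesis
      using kronecker_frac_imp_eq[OF False] kronecker_frac_mult[OF False] by (metis mult.commute)
  qed
  finally show ?thesis
    by (simp add: D_def)
qed

section \<open>Eta-quotients\<close>

text \<open>Writing \<open>n = p x\<close>, the prime case is applied at \<open>x \<tau>\<close> to the matrix with entries
  \<open>a, b x, c / x, d\<close>, which has the same automorphy factor.\<close>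

lemma dedekind_eta_level_modular:
  fixes a b c d :: int and n :: nat
  assumes \<tau>: "Im \<tau> > 0" and det: "a * d - b * c = 1"
    and n: "odd n" and c: "int n ^ 2 dvd c"
  defines "J \<equiv> of_int c * \<tau> + of_int d"
  defines "\<tau>' \<equiv> (of_int a * \<tau> + of_int b) / J"
  shows "dedekind_eta (of_nat n * \<tau>') * dedekind_eta \<tau> ^ n * J ^ ((n - 1) div 2) =
    of_int (kronecker d n) * dedekind_eta (of_nat n * \<tau>) * dedekind_eta \<tau>' ^ n"
  using n c
proof (induction n rule: prime_divisors_induct)
  case (factor p x)
  have p: "prime p" "odd p" "odd x" "p > 2"
    using factor by (auto simp: prime_gt_0_nat dest: prime_ge_2_nat intro: ccontr)
      (metis even_mult_iff le_neq_implies_less prime_ge_2_nat even_numeral)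
  have x: "x > 0"
    using p(3) by (rule odd_pos)
  obtain y where y: "c = int (p * x) ^ 2 * y"
    using factor.prems(2) by (rule dvdE)
  define c' where "c' = int p ^ 2 * int x * y"
  have c': "c = int x * c'"
    by (simp add: y c'_def power2_eq_square mult_ac)
  have \<tau>'_pos: "Im \<tau>' > 0"
    using Im_moebius_pos[OF \<tau> det] by (simp add: \<tau>'_def J_def)
  have x\<tau>: "Im (of_nat x * \<tau>) > 0" "Im (of_nat x * \<tau>') > 0"
    using \<tau> \<tau>'_pos x by simp_all
  have "int x ^ 2 dvd c"
    by (simp add: c' c'_def power2_eq_square)
  \<comment> \<open>The law for \<open>x\<close> is raised to the power \<open>p\<close> because the
    prime law at \<open>x \<tau>\<close> contains the \<open>p\<close>-th powers of eta at
    \<open>x \<tau>\<close> and \<open>x \<tau>'\<close>.\<close>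
  from factor.IH[OF p(3) this]
  have "(dedekind_eta (of_nat x * \<tau>') * dedekind_eta \<tau> ^ x * J ^ ((x - 1) div 2)) ^ p =
      (of_int (kronecker d x) * dedekind_eta (of_nat x * \<tau>) * dedekind_eta \<tau>' ^ x) ^ p"
    by simp
  then have IH: "dedekind_eta (of_nat x * \<tau>') ^ p * dedekind_eta \<tau> ^ (p * x) * J ^ (p * ((x - 1) div 2)) =
      of_int (kronecker d x) ^ p * dedekind_eta (of_nat x * \<tau>) ^ p * dedekind_eta \<tau>' ^ (p * x)"
    by (simp add: power_mult_distrib power_mult [symmetric] mult.commute[of p])
  have "dedekind_eta (of_nat p * ((of_int a * (of_nat x * \<tau>) + of_int (b * int x)) /
        (of_int c' * (of_nat x * \<tau>) + of_int d))) * dedekind_eta (of_nat x * \<tau>) ^ p *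
        (of_int c' * (of_nat x * \<tau>) + of_int d) ^ ((p - 1) div 2) =
      of_int (Legendre d p) * dedekind_eta (of_nat p * (of_nat x * \<tau>)) *
        dedekind_eta ((of_int a * (of_nat x * \<tau>) + of_int (b * int x)) /
          (of_int c' * (of_nat x * \<tau>) + of_int d)) ^ p"
  proof (rule dedekind_eta_prime_modular[OF x\<tau>(1) _ p(1,4)])
    show "a * d - b * int x * c' = 1"
      using det by (simp add: c' mult_ac)
    show "int p ^ 2 dvd c'"
      by (simp add: c'_def)
  qed
  moreover have "of_int c' * (of_nat x * \<tau>) + of_int d = J"
    by (simp add: J_def c' mult_ac)
  moreover have "(of_int a * (of_nat x * \<tau>) + of_int (b * int x)) / J = of_nat x * \<tau>'"
    by (simp add: \<tau>'_def distrib_left mult_ac)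
  ultimately have P: "dedekind_eta (of_nat p * (of_nat x * \<tau>')) * dedekind_eta (of_nat x * \<tau>) ^ p *
        J ^ ((p - 1) div 2) =
      of_int (Legendre d p) * dedekind_eta (of_nat p * (of_nat x * \<tau>)) * dedekind_eta (of_nat x * \<tau>') ^ p"
    by (simp only:)
  have "kronecker d (int (p * x)) = kronecker d (int p) * kronecker d (int x)"
    using kronecker_mult_right[of "int p" "int x" d] x p(1) by (simp add: prime_gt_0_nat)
  also have "kronecker d (int p) = Legendre d p"
    using p by (simp add: kronecker_prime_right kronecker_prime_def)
  \<comment> \<open>An odd power does not change a value among \<open>-1\<close>, \<open>0\<close>,
    \<open>1\<close>.\<close>
  also have "kronecker d (int x) = kronecker d (int x) ^ p"
    using kronecker_range[of d "int x"] p(1,2) by (auto simp: zero_power prime_gt_0_nat)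
  finally have K: "(of_int (kronecker d (int (p * x))) :: complex) =
      of_int (Legendre d p) * of_int (kronecker d (int x)) ^ p"
    by simp
  have E: "(p * x - 1) div 2 = (p - 1) div 2 + p * ((x - 1) div 2)"
  proof -
    obtain i j where "p = 2 * i + 1" "x = 2 * j + 1"
      using p(2,3) by (auto elim!: oddE)
    then show ?thesis
      by (simp add: algebra_simps)
  qed
  define u where "u = dedekind_eta (of_nat x * \<tau>) ^ p * dedekind_eta (of_nat x * \<tau>') ^ p"
  have u: "u \<noteq> 0"
    using dedekind_eta_nonzero x\<tau> by (simp add: u_def)
  have "u * (dedekind_eta (of_nat (p * x) * \<tau>') * dedekind_eta \<tau> ^ (p * x) * J ^ ((p * x - 1) div 2)) =
      (dedekind_eta (of_nat p * (of_nat x * \<tau>')) * dedekind_eta (of_nat x * \<tau>) ^ p * J ^ ((p - 1) div 2)) *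
      (dedekind_eta (of_nat x * \<tau>') ^ p * dedekind_eta \<tau> ^ (p * x) * J ^ (p * ((x - 1) div 2)))"
    unfolding E power_add by (simp add: u_def mult_ac)
  also have "\<dots> = u * (of_int (kronecker d (int (p * x))) * dedekind_eta (of_nat (p * x) * \<tau>) *
      dedekind_eta \<tau>' ^ (p * x))"
    unfolding P IH K by (simp add: u_def mult_ac)
  finally show ?case
    using u by simp
qed auto

lemma power_int_sum:
  fixes x :: "'a :: field"
  assumes "x \<noteq> 0"
  shows "x powi (sum f I) = (\<Prod>i\<in>I. x powi f i)"
  by (induction I rule: infinite_finite_induct) (auto simp: power_int_add assms)

text \<open>Each factor contributes a symbol, a power of the eta ratio and a power of
  \<open>J\<close>. Since the exponents of the ratio sum to \<open>24 * t\<close>, only the 24th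
  power law of eta is required.\<close>

lemma eta_quotient_modular:
  fixes a b c d k t :: int and N :: nat and r :: "nat \<Rightarrow> int"
  assumes \<tau>: "Im \<tau> > 0" and det: "a * d - b * c = 1"
    and N: "odd N" and c: "int N ^ 2 dvd c"
    and t: "(\<Sum>\<delta> | \<delta> dvd N. int \<delta> * r \<delta>) = 24 * t" and k: "(\<Sum>\<delta> | \<delta> dvd N. r \<delta>) = 2 * k"
  defines "J \<equiv> of_int c * \<tau> + of_int d"
  shows "eta_quotient N r ((of_int a * \<tau> + of_int b) / J) =
    (\<Prod>\<delta> | \<delta> dvd N. of_int (kronecker d \<delta>) powi r \<delta>) * J powi k * eta_quotient N r \<tau>"
proof -
  define \<tau>' where "\<tau>' = (of_int a * \<tau> + of_int b) / J"
  define D where "D = {\<delta>. \<delta> dvd N}"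
  define e where "e \<delta> = (\<delta> - 1) div 2" for \<delta> :: nat
  define \<rho> where "\<rho> = dedekind_eta \<tau>' / dedekind_eta \<tau>"
  have J: "J \<noteq> 0" and \<tau>': "Im \<tau>' > 0"
    using Im_moebius_pos[OF \<tau> det] by (simp_all add: \<tau>'_def J_def)
  have nz: "dedekind_eta \<tau> \<noteq> 0" "dedekind_eta \<tau>' \<noteq> 0"
    using \<tau> \<tau>' by (simp_all add: dedekind_eta_nonzero)
  have \<rho>: "\<rho> \<noteq> 0" "\<rho> ^ 24 = J ^ 12"
  proof -
    show "\<rho> \<noteq> 0"
      using nz by (simp add: \<rho>_def)
    have "dedekind_eta \<tau>' ^ 24 = J ^ 12 * dedekind_eta \<tau> ^ 24"
      unfolding \<tau>'_def J_def by (rule dedekind_eta_pow_24_modular[OF \<tau> det])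
    then show "\<rho> ^ 24 = J ^ 12"
      using nz by (simp add: \<rho>_def power_divide)
  qed
  have odd: "odd \<delta>" if "\<delta> \<in> D" for \<delta>
    using that N dvd_trans[of 2 \<delta> N] by (auto simp: D_def)
  have "dedekind_eta (of_nat \<delta> * \<tau>') powi r \<delta> = of_int (kronecker d \<delta>) powi r \<delta> *
      \<rho> powi (int \<delta> * r \<delta>) * J powi (- (int (e \<delta>) * r \<delta>)) * dedekind_eta (of_nat \<delta> * \<tau>) powi r \<delta>"
    if \<delta>: "\<delta> \<in> D" for \<delta>
  proof -
    have "int \<delta> ^ 2 dvd int N ^ 2"
      using \<delta> by (simp add: D_def)
    then have "int \<delta> ^ 2 dvd c"
      using c by (rule dvd_trans)
    from dedekind_eta_level_modular[OF \<tau> det odd[OF \<delta>] this]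
    have "dedekind_eta (of_nat \<delta> * \<tau>') * dedekind_eta \<tau> ^ \<delta> * J ^ e \<delta> =
        of_int (kronecker d \<delta>) * dedekind_eta (of_nat \<delta> * \<tau>) * dedekind_eta \<tau>' ^ \<delta>"
      by (simp add: \<tau>'_def J_def e_def)
    then have "dedekind_eta (of_nat \<delta> * \<tau>') = of_int (kronecker d \<delta>) * \<rho> ^ \<delta> * inverse (J ^ e \<delta>) *
        dedekind_eta (of_nat \<delta> * \<tau>)"
      using nz J by (simp add: \<rho>_def field_simps)
    then show ?thesis
      by (simp add: power_int_mult_distrib power_int_mult power_int_minus power_int_inverse)
  qed
  then have "eta_quotient N r \<tau>' = (\<Prod>\<delta>\<in>D. of_int (kronecker d \<delta>) powi r \<delta> *
      \<rho> powi (int \<delta> * r \<delta>) * J powi (- (int (e \<delta>) * r \<delta>)) * dedekind_eta (of_nat \<delta> * \<tau>) powi r \<delta>)"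
    unfolding eta_quotient_def D_def [symmetric] by (intro prod.cong) auto
  also have "\<dots> = (\<Prod>\<delta>\<in>D. of_int (kronecker d \<delta>) powi r \<delta>) * \<rho> powi (\<Sum>\<delta>\<in>D. int \<delta> * r \<delta>) *
      J powi (\<Sum>\<delta>\<in>D. - (int (e \<delta>) * r \<delta>)) * eta_quotient N r \<tau>"
    by (simp add: prod.distrib power_int_sum \<rho> J eta_quotient_def D_def [symmetric])
  also have "\<rho> powi (\<Sum>\<delta>\<in>D. int \<delta> * r \<delta>) = J powi (12 * t)"
  proof -
    have "\<rho> powi (24 * t) = (\<rho> ^ 24) powi t"
      by (simp add: power_int_mult)
    also have "\<dots> = J powi (12 * t)"
      by (simp add: \<rho> power_int_mult)
    finally show ?thesis
      using t by (simp add: D_def)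
  qed
  \<comment> \<open>Writing each odd \<open>\<delta>\<close> as \<open>2 * e \<delta> + 1\<close>
    turns the sum \<open>24 * t\<close> into twice the sum of \<open>e \<delta> * r \<delta>\<close>
    plus \<open>2 * k\<close>. The total weight is then
    \<open>12 * t + (k - 12 * t) = k\<close>.\<close>
  also have "(\<Sum>\<delta>\<in>D. - (int (e \<delta>) * r \<delta>)) = k - 12 * t"
  proof -
    have "int \<delta> * r \<delta> = 2 * (int (e \<delta>) * r \<delta>) + r \<delta>" if "\<delta> \<in> D" for \<delta>
    proof -
      have "int \<delta> = 2 * int (e \<delta>) + 1"
        using odd[OF that] by (auto simp: e_def elim!: oddE)
      then show ?thesis
        by (simp add: algebra_simps)
    qed
    then have "(\<Sum>\<delta>\<in>D. int \<delta> * r \<delta>) = 2 * (\<Sum>\<delta>\<in>D. int (e \<delta>) * r \<delta>) + (\<Sum>\<delta>\<in>D. r \<delta>)"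
      by (simp add: sum.distrib sum_distrib_left)
    then show ?thesis
      using t k by (simp add: D_def sum_negf)
  qed
  also have "(\<Prod>\<delta>\<in>D. of_int (kronecker d \<delta>) powi r \<delta>) * J powi (12 * t) * J powi (k - 12 * t) *
      eta_quotient N r \<tau> =
      (\<Prod>\<delta>\<in>D. of_int (kronecker d \<delta>) powi r \<delta>) * J powi k * eta_quotient N r \<tau>"
    using J by (simp add: power_int_diff)
  finally show ?thesis
    by (simp add: \<tau>'_def D_def)
qed

lemma eta_quotient_nonzero:
  assumes "Im \<tau> > 0" "N > 0"
  shows "eta_quotient N r \<tau> \<noteq> 0"
proof -
  have "dedekind_eta (of_nat \<delta> * \<tau>) \<noteq> 0" if "\<delta> dvd N" for \<delta>
  proof -
    have "\<delta> > 0"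
      using assms(2) that by (rule dvd_pos_nat)
    then show ?thesis
      using assms(1) by (intro dedekind_eta_nonzero) simp
  qed
  then show ?thesis
    using assms by (simp add: eta_quotient_def power_int_eq_0_iff)
qed

section \<open>Integer translations of eta-quotients\<close>

lemma e2pi_power_int: "e2pi z powi n = e2pi (of_int n * z)"
  by (simp add: power_int_def e2pi_power e2pi_minus [symmetric] power_inverse)

lemma eta_quotient_plus_of_int:
  fixes m :: int
  shows "eta_quotient N r (\<tau> + of_int m) =
    e2pi (of_int (m * (\<Sum>\<delta> | \<delta> dvd N. int \<delta> * r \<delta>)) / 24) * eta_quotient N r \<tau>"
proof -
  have eta: "dedekind_eta (of_nat \<delta> * (\<tau> + of_int m)) = e2pi (of_int (m * int \<delta>) / 24) * dedekind_eta (of_nat \<delta> * \<tau>)"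
    for \<delta>
  proof -
    have 1: "e2pi (of_nat \<delta> * (\<tau> + of_int m)) = e2pi (of_nat \<delta> * \<tau>)"
      by (rule e2pi_cong[of _ _ "int \<delta> * m"]) (simp add: algebra_simps)
    have "e2pi (of_nat \<delta> * (\<tau> + of_int m) / 24) = e2pi (of_int (m * int \<delta>) / 24 + of_nat \<delta> * \<tau> / 24)"
      by (rule arg_cong[of _ _ e2pi]) (simp add: field_simps)
    then show ?thesis
      unfolding dedekind_eta_eq 1 e2pi_add by (simp only: mult.assoc)
  qed
  have sum: "(\<Prod>\<delta>\<in>D. e2pi (f \<delta>)) = e2pi (sum f D)" for f and D :: "nat set"
    by (induction D rule: infinite_finite_induct) (auto simp: e2pi_add)
  have "eta_quotient N r (\<tau> + of_int m) =
      (\<Prod>\<delta> | \<delta> dvd N. e2pi (of_int (r \<delta>) * (of_int (m * int \<delta>) / 24))) * eta_quotient N r \<tau>"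
    unfolding eta_quotient_def eta power_int_mult_distrib e2pi_power_int prod.distrib ..
  also have "(\<Prod>\<delta> | \<delta> dvd N. e2pi (of_int (r \<delta>) * (of_int (m * int \<delta>) / 24))) =
      e2pi (of_int (m * (\<Sum>\<delta> | \<delta> dvd N. int \<delta> * r \<delta>)) / 24)"
    unfolding sum by (rule arg_cong[of _ _ e2pi])
      (simp add: sum_distrib_left sum_divide_distrib mult_ac)
  finally show ?thesis .
qed

section \<open>Transfer of the transformation law from \<open>Gamma_principal N\<close> to
  \<open>Gamma_0 N\<close>\<close>

theorem theorem1p7:
  fixes N :: nat and r :: "nat \<Rightarrow> int" and k :: int and s :: rat and chi :: "int \<Rightarrow> complex"
  assumes "N > 0" and "gcd N 6 = 1"
    and k: "of_int k = (1 / 2 :: rat) * of_int (\<Sum>\<delta> | \<delta> dvd N. r \<delta>)"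
    and s: "s = (\<Prod>\<delta> | \<delta> dvd N. of_nat \<delta> powi r \<delta>)"
    and "\<And>d. chi d = of_int (kronecker_rat ((-1) powi k * s) d)"
    and "eta_quotient N r \<in> weakly_holomorphic_forms k (Gamma_principal N)"
  shows "eta_quotient N r \<in> weakly_holomorphic_forms_char k N chi"
proof -
  let ?f = "eta_quotient N r"
  have "coprime N 6"
    using assms(2) unfolding coprime_iff_gcd_eq_1 .
  then have odd: "odd N" and "coprime N 3"
    using coprime_mult_right_iff[of N 2 3] by simp_all
  then have cop24: "coprime 24 (int N)"
  proof -
    have "coprime N (2 ^ 3 * 3)"
      unfolding coprime_mult_right_iff coprime_power_right_iff using odd \<open>coprime N 3\<close> by simp
    then show ?thesis
      using coprime_int_iff[of N 24] by (simp add: coprime_commute)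
  qed
  have "(of_int (2 * k) :: rat) = of_int (\<Sum>\<delta> | \<delta> dvd N. r \<delta>)"
    using k by simp
  then have k2: "(\<Sum>\<delta> | \<delta> dvd N. r \<delta>) = 2 * k"
    by (simp only: of_int_eq_iff)
  have inv: "?f ((of_int a * \<tau> + of_int b) / (of_int c * \<tau> + of_int d)) =
      (of_int c * \<tau> + of_int d) powi k * ?f \<tau>"
    if "Im \<tau> > 0" "a * d - b * c = 1" "[a = 1] (mod int N)" "[b = 0] (mod int N)"
      "[c = 0] (mod int N)" "[d = 1] (mod int N)" for a b c d :: int and \<tau>
  proof -
    define A :: "int ^ 2 ^ 2" where "A = vector [vector [a, b], vector [c, d]]"
    have A: "A $ 1 $ 1 = a" "A $ 1 $ 2 = b" "A $ 2 $ 1 = c" "A $ 2 $ 2 = d"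
      by (simp_all add: A_def)
    have "A \<in> Gamma_principal N"
      using that by (simp add: Gamma_principal_def SL2Z_def det_2 A)
    then have "?f (act A \<tau>) = aut_factor A \<tau> powi k * ?f \<tau>"
      using assms(6) that(1) by (simp add: weakly_holomorphic_forms_def upper_half_plane_def)
    then show ?thesis
      by (simp add: act_def aut_factor_def moebius_def A)
  qed
  obtain t where t: "(\<Sum>\<delta> | \<delta> dvd N. int \<delta> * r \<delta>) = 24 * t"
  proof -
    define S where "S = (\<Sum>\<delta> | \<delta> dvd N. int \<delta> * r \<delta>)"
    \<comment> \<open>Translation by \<open>N\<close> belongs to \<open>Gamma_principal N\<close>
      and the eta-quotient is nonzero at \<open>\<i>\<close>, so the root of unity from the
      translation is \<open>1\<close>. Hence \<open>24\<close> divides \<open>N * S\<close>, and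
      \<open>N\<close> is prime to \<open>24\<close>.\<close>
    have "?f (\<i> + of_int (int N)) = ?f \<i>"
      using inv[of \<i> 1 1 "int N" 0] by (simp add: cong_0_iff)
    then have "e2pi (of_int (int N * S) / 24) = 1"
      using eta_quotient_plus_of_int[of N r \<i> "int N"] eta_quotient_nonzero[of \<i> N r] \<open>N > 0\<close>
      by (simp add: S_def)
    then obtain n where "(of_int (int N * S) / 24 :: complex) = of_int n"
      by (auto simp: e2pi_eq_1_iff)
    then have "(of_int (int N * S) :: complex) = of_int (24 * n)"
      by (simp add: field_simps)
    then have "int N * S = 24 * n"
      by (simp only: of_int_eq_iff)
    then have "24 dvd int N * S"
      by simp
    then have "24 dvd S"
      using cop24 coprime_dvd_mult_right_iff by blast
    then show thesis
      using that by (auto simp: S_def)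
  qed
  have chi: "chi d = (\<Prod>\<delta> | \<delta> dvd N. of_int (kronecker d \<delta>) powi r \<delta>)" if d: "coprime d (int N)" for d
  proof -
    \<comment> \<open>Halving the identity \<open>24 * t = 2 * (\<Sum>\<delta>. r \<delta> *
      ((\<delta> - 1) div 2)) + 2 * k\<close> gives the parity needed for reciprocity.\<close>
    have "(\<Sum>\<delta> | \<delta> dvd N. r \<delta> * int ((\<delta> - 1) div 2)) - k = 2 * (6 * t - k)"
    proof -
      have "int \<delta> * r \<delta> = 2 * (r \<delta> * int ((\<delta> - 1) div 2)) + r \<delta>" if "\<delta> dvd N" for \<delta>
      proof -
        have "odd \<delta>"
          using that odd dvd_trans[of 2 \<delta> N] by auto
        then have "int \<delta> = 2 * int ((\<delta> - 1) div 2) + 1"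
          by (auto elim!: oddE)
        then show ?thesis
          by (metis add.commute distrib_right mult.assoc mult.commute mult_1)
      qed
      then have "(\<Sum>\<delta> | \<delta> dvd N. int \<delta> * r \<delta>) =
          (\<Sum>\<delta> | \<delta> dvd N. 2 * (r \<delta> * int ((\<delta> - 1) div 2)) + r \<delta>)"
        by (intro sum.cong) auto
      then show ?thesis
        using t k2 by (simp add: sum.distrib sum_distrib_left [symmetric])
    qed
    then have "even ((\<Sum>\<delta> | \<delta> dvd N. r \<delta> * int ((\<delta> - 1) div 2)) - k)"
      by (metis dvd_triv_left)
    then have "chi d = of_int (\<Prod>\<delta> | \<delta> dvd N. kronecker d \<delta> ^ nat \<bar>r \<delta>\<bar>)"
      unfolding assms(5) s by (simp only: prod_kronecker_eq_kronecker_rat[OF odd d])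
    also have "\<dots> = (\<Prod>\<delta> | \<delta> dvd N. of_int (kronecker d \<delta>) powi r \<delta>)"
      unfolding of_int_prod
    proof (rule prod.cong)
      fix \<delta> assume "\<delta> \<in> {\<delta>. \<delta> dvd N}"
      then have "kronecker d \<delta> \<in> {-1, 1}"
        using d \<open>N > 0\<close> coprime_divisors[of d d "int \<delta>" "int N"]
        by (intro kronecker_unit) (auto intro: Nat.gr0I)
      \<comment> \<open>The symbol is \<open>1\<close> or \<open>- 1\<close> here, so neither the
        sign of the exponent nor the passage to its absolute value matters.\<close>
      then show "(of_int (kronecker d \<delta> ^ nat \<bar>r \<delta>\<bar>) :: complex) = of_int (kronecker d \<delta>) powi r \<delta>"
        by (auto simp: power_int_def minus_one_power_iff)
    qed simp
    finally show ?thesis .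
  qed
  have "?f (act A \<tau>) = chi (A $ 2 $ 2) * aut_factor A \<tau> powi k * ?f \<tau>"
    if A: "A \<in> Gamma_0 N" and "\<tau> \<in> upper_half_plane" for A \<tau>
  proof -
    define a b c d where "a = A $ 1 $ 1" and "b = A $ 1 $ 2" and "c = A $ 2 $ 1" and "d = A $ 2 $ 2"
    have \<tau>: "Im \<tau> > 0"
      using that(2) by (simp add: upper_half_plane_def)
    have det: "a * d - b * c = 1" and "int N dvd c"
      using A by (simp_all add: Gamma_0_def SL2Z_def det_2 a_def b_def c_def d_def cong_0_iff)
    from \<open>int N dvd c\<close> obtain c0 where c0: "c = int N * c0"
      by (rule dvdE)
    have "coprime d (int N)"
    proof (rule coprimeI)
      fix l assume l: "l dvd d" "l dvd int N"
      then have "l dvd a * d - b * c"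
        by (simp add: c0)
      then show "is_unit l"
        by (simp add: det)
    qed
    \<comment> \<open>Right multiplication by \<open>(1, 0; N x, 1) \<in> \<Gamma>(N)\<close> keeps \<open>d\<close> and makes the lower left entry
      divisible by \<open>N\<^sup>2\<close>.\<close>
    then obtain y where "[d * y = 1] (mod int N)"
      using cong_solve_coprime_int by blast
    \<comment> \<open>Since \<open>y\<close> inverts \<open>d\<close> modulo \<open>N\<close>, this
      \<open>x\<close> makes \<open>c0 + d * x\<close> divisible by \<open>N\<close>; the new lower
      left entry is \<open>N * (c0 + d * x)\<close>.\<close>
    define x where "x = - (c0 * y)"
    have "int N dvd c0 + d * x"
    proof -
      have "c0 + d * x = - (c0 * (d * y - 1))"
        by (simp add: x_def algebra_simps)
      moreover have "int N dvd d * y - 1"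
        using \<open>[d * y = 1] (mod int N)\<close> by (simp add: cong_iff_dvd_diff)
      ultimately show ?thesis
        by simp
    qed
    define n where "n = int N * x"
    \<comment> \<open>The inverse matrix \<open>(1, 0; - n, 1)\<close> sends \<open>\<tau>\<close>
      to \<open>\<tau> / u\<close> and has automorphy factor \<open>u\<close>. The product matrix
      sends \<open>\<tau> / u\<close> to \<open>act A \<tau>\<close> with automorphy factor
      \<open>J / u\<close>, so the powers of \<open>u\<close> cancel.\<close>
    define u where "u = 1 - of_int n * \<tau>"
    define J where "J = of_int c * \<tau> + of_int d"
    have u: "u \<noteq> 0" and \<tau>u: "Im (\<tau> / u) > 0"
      using Im_moebius_pos[OF \<tau>, of 1 1 0 "- n"] by (simp_all add: u_def)
    have fu: "?f (\<tau> / u) = u powi k * ?f \<tau>"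
      using inv[OF \<tau>, of 1 1 0 "- n"] by (simp add: u_def n_def cong_0_iff)
    have det': "(a + b * n) * d - b * (c + d * n) = 1"
      using det by (simp add: algebra_simps)
    have "int N ^ 2 dvd c + d * n"
    proof -
      have "c + d * n = int N * (c0 + d * x)"
        by (simp add: c0 n_def algebra_simps)
      then show ?thesis
        using \<open>int N dvd c0 + d * x\<close> by (simp add: power2_eq_square)
    qed
    from eta_quotient_modular[OF \<tau>u det' odd this t k2]
    have "?f ((of_int (a + b * n) * (\<tau> / u) + of_int b) / (of_int (c + d * n) * (\<tau> / u) + of_int d)) =
        chi d * (of_int (c + d * n) * (\<tau> / u) + of_int d) powi k * ?f (\<tau> / u)"
      by (simp only: chi[OF \<open>coprime d (int N)\<close>])
    moreover have num: "of_int (a + b * n) * (\<tau> / u) + of_int b = (of_int a * \<tau> + of_int b) / u"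
    proof -
      have "of_int (a + b * n) * \<tau> + of_int b * u = of_int a * \<tau> + of_int b"
        by (simp add: u_def algebra_simps)
      then show ?thesis
        using u by (simp add: divide_add_eq_iff)
    qed
    moreover have den: "of_int (c + d * n) * (\<tau> / u) + of_int d = J / u"
    proof -
      have "of_int (c + d * n) * \<tau> + of_int d * u = J"
        by (simp add: u_def J_def algebra_simps)
      then show ?thesis
        using u by (simp add: divide_add_eq_iff)
    qed
    ultimately have "?f ((of_int a * \<tau> + of_int b) / J) = chi d * (J / u) powi k * (u powi k * ?f \<tau>)"
      using u fu by simp
    then have "?f ((of_int a * \<tau> + of_int b) / J) = chi d * J powi k * ?f \<tau>"
      using u by (simp add: power_int_divide_distrib)
    then show ?thesis
      by (simp add: act_def aut_factor_def moebius_def J_def a_def b_def c_def d_def)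
  qed
  then show ?thesis
    using assms(6) by (simp add: weakly_holomorphic_forms_def weakly_holomorphic_forms_char_def)
qed

end
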